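(* Let $\mathcal{M}$ be a countable structure in a countable relational language and $\alpha\ge1$ a countable ordinal. Let $(\Gamma_i)_{i \in \omega}$ be a list of $\Pi_{\alpha}$-types none of which is $\Sigma_{\alpha}$-supported in $\mathcal{M}$, and let $\chi$ be a $\forall\mathfrak{E}_\alpha$ sentence true in $\mathcal{M}$. Then there is a structure $\mathcal{N}$ such that $\mathcal{N} \models \chi$ and $\mathcal{N}$ omits every $\Gamma_i$.
   Context: Formulas are in $\mathcal{L}_{\omega_1\omega}$. $\Sigma_0=\Pi_0$ are the finitary quantifier-free formulas; a $\Sigma_\alpha$ formula is $\bigvee_i \exists \bar{y}_i \psi_i$ and a $\Pi_\alpha$ formula is $\bigwedge_i \forall \bar{y}_i \psi_i$ (countable index sets), with each $\psi_i$ in $\Pi_\beta$ for some $\beta<\alpha$. The classes ($\alpha\ge1$): $\mathfrak{A}_1 = \Pi_1$, $\mathfrak{E}_1 = \Sigma_1$; for $\alpha>1$, $\mathfrak{A}_\alpha$ is the closure of $\bigcup_{\beta<\alpha}\overline{\mathfrak{E}}_\beta$ under $\forall$ and countable conjunctions, and $\mathfrak{E}_\alpha$ is the closure of $\bigcup_{\beta<\alpha}\overline{\mathfrak{A}}_\beta$ under $\exists$ and countable disjunctions; $\overline{\mathfrak{E}}_\alpha$ (resp. $\overline{\mathfrak{A}}_\alpha$) is the closure of $\mathfrak{E}_\alpha$ (resp. $\mathfrak{A}_\alpha$) under countable conjunctions and disjunctions. A $\forall\mathfrak{E}_\alpha$ formula is one of the form $\bigwedge_{i\in\omega}\forall\bar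 x_i\,\phi_i(\bar x_i)$ with each $\phi_i\in\mathfrak{E}_\alpha$. A $\Pi_\alpha$-type $\Gamma(\bar x)$ is a set of $\Pi_\alpha$ formulas in free variables $\bar x$; it is $\Sigma_\alpha$-supported in $\mathcal{M}$ if there is a $\Sigma_\alpha$ formula $\theta(\bar x)$ satisfied by some tuple of $\mathcal{M}$ such that every tuple of $\mathcal{M}$ satisfying $\theta$ satisfies every formula of $\Gamma$. A structure omits $\Gamma$ if no tuple of it satisfies all formulas of $\Gamma$. *)

theory Defs
  imports Main "HOL-Library.Countable_Set_Type"
begin

text \<open>A relational language is a partial map from symbols to arities, its symbols being
  the domain of the map.\<close>

type_synonym 'r language = "'r \<rightharpoonup> nat"

record ('a, 'r) fo_struct =
  carrier :: "'a set"
  interp :: "'r \<Rightarrow> 'a list set"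

definition structure_for :: "'r language \<Rightarrow> ('a, 'r) fo_struct \<Rightarrow> bool" where
  "structure_for L M \<longleftrightarrow>
     carrier M \<noteq> {} \<and>
     (\<forall>r n. L r = Some n \<longrightarrow> interp M r \<subseteq> {as. length as = n \<and> set as \<subseteq> carrier M})"

text \<open>Formulas of $L_{\omega_1\omega}$ with equality. Variables are natural numbers, and
  conjunctions and disjunctions range over countable (possibly empty) sets of formulas.
  That formulas have only finitely many free variables is not built in: below, every formula
  that is used is required to have its free variables among a finite tuple, and this property
  is inherited by all its subformulas.\<close>

datatype 'r fm =
    Eq nat nat
  | Rel 'r "nat list"
  | Neg "'r fm"
  | Conj "'r fm cset"
  | Disj "'r fm cset"
  | Ex nat "'r fm"
  | All nat "'r fm"

abbreviation exs :: "nat list \<Rightarrow> 'r fm \<Rightarrow> 'r fm" where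
  "exs ys \<phi> \<equiv> foldr Ex ys \<phi>"

abbreviation alls :: "nat list \<Rightarrow> 'r fm \<Rightarrow> 'r fm" where
  "alls ys \<phi> \<equiv> foldr All ys \<phi>"

primrec fv :: "'r fm \<Rightarrow> nat set" where
  "fv (Eq x y) = {x, y}"
| "fv (Rel r xs) = set xs"
| "fv (Neg \<phi>) = fv \<phi>"
| "fv (Conj \<Phi>) = \<Union> (rcset (cimage fv \<Phi>))"
| "fv (Disj \<Phi>) = \<Union> (rcset (cimage fv \<Phi>))"
| "fv (Ex x \<phi>) = fv \<phi> - {x}"
| "fv (All x \<phi>) = fv \<phi> - {x}"

primrec sat :: "('a, 'r) fo_struct \<Rightarrow> 'r fm \<Rightarrow> (nat \<Rightarrow> 'a) \<Rightarrow> bool" where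
  "sat M (Eq x y) = (\<lambda>v. v x = v y)"
| "sat M (Rel r xs) = (\<lambda>v. map v xs \<in> interp M r)"
| "sat M (Neg \<phi>) = (\<lambda>v. \<not> sat M \<phi> v)"
| "sat M (Conj \<Phi>) = (\<lambda>v. \<forall>s \<in> rcset (cimage (sat M) \<Phi>). s v)"
| "sat M (Disj \<Phi>) = (\<lambda>v. \<exists>s \<in> rcset (cimage (sat M) \<Phi>). s v)"
| "sat M (Ex x \<phi>) = (\<lambda>v. \<exists>a \<in> carrier M. sat M \<phi> (v(x := a)))"
| "sat M (All x \<phi>) = (\<lambda>v. \<forall>a \<in> carrier M. sat M \<phi> (v(x := a)))"

definition models :: "('a, 'r) fo_struct \<Rightarrow> 'r fm \<Rightarrow> bool" where
  "models M \<phi> \<longleftrightarrow> (\<forall>v. range v \<subseteq> carrier M \<longrightarrow> sat M \<phi> v)"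

definition tuples :: "('a, 'r) fo_struct \<Rightarrow> nat \<Rightarrow> 'a list set" where
  "tuples M n = {as. length as = n \<and> set as \<subseteq> carrier M}"

text \<open>Satisfaction by a tuple \<open>as\<close> of a formula with free variables among the distinct
  variables \<open>xs\<close>; the value of the assignment outside \<open>xs\<close> is immaterial.\<close>

definition sat_tuple :: "('a, 'r) fo_struct \<Rightarrow> nat list \<Rightarrow> 'r fm \<Rightarrow> 'a list \<Rightarrow> bool" where
  "sat_tuple M xs \<phi> as \<longleftrightarrow> sat M \<phi> (\<lambda>x. the (map_of (zip xs as) x))"

text \<open>An ordinal is given as an element \<open>\<alpha>\<close> of an arbitrary well-ordered type, standing for
  the order type of its set of predecessors.\<close>

definition ord_zero :: "'o::wellorder \<Rightarrow> bool" where
  "ord_zero \<alpha> \<longleftrightarrow> {..<\<alpha>} = {}"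

definition ord_one :: "'o::wellorder \<Rightarrow> bool" where
  "ord_one \<alpha> \<longleftrightarrow> (\<exists>\<beta>. {..<\<alpha>} = {\<beta>})"

definition ord_gt_one :: "'o::wellorder \<Rightarrow> bool" where
  "ord_gt_one \<alpha> \<longleftrightarrow> \<not> ord_zero \<alpha> \<and> \<not> ord_one \<alpha>"

inductive qf_fm :: "'r language \<Rightarrow> 'r fm \<Rightarrow> bool" for L where
  qf_Eq: "qf_fm L (Eq x y)"
| qf_Rel: "L r = Some (length xs) \<Longrightarrow> qf_fm L (Rel r xs)"
| qf_Neg: "qf_fm L \<phi> \<Longrightarrow> qf_fm L (Neg \<phi>)"
| qf_Conj: "finite (rcset \<Phi>) \<Longrightarrow> \<forall>\<phi> \<in> rcset \<Phi>. qf_fm L \<phi> \<Longrightarrow> qf_fm L (Conj \<Phi>)"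
| qf_Disj: "finite (rcset \<Phi>) \<Longrightarrow> \<forall>\<phi> \<in> rcset \<Phi>. qf_fm L \<phi> \<Longrightarrow> qf_fm L (Disj \<Phi>)"

inductive Sigma_fm Pi_fm :: "'r language \<Rightarrow> 'o::wellorder \<Rightarrow> 'r fm \<Rightarrow> bool" for L where
  Sigma_zero: "ord_zero \<alpha> \<Longrightarrow> qf_fm L \<phi> \<Longrightarrow> Sigma_fm L \<alpha> \<phi>"
| Pi_zero: "ord_zero \<alpha> \<Longrightarrow> qf_fm L \<phi> \<Longrightarrow> Pi_fm L \<alpha> \<phi>"
| Sigma_pos: "\<not> ord_zero \<alpha> \<Longrightarrow>
    \<forall>\<phi> \<in> rcset \<Phi>. \<exists>ys \<psi> \<beta>. \<phi> = exs ys \<psi> \<and> \<beta> < \<alpha> \<and> Pi_fm L \<beta> \<psi> \<Longrightarrow>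
    Sigma_fm L \<alpha> (Disj \<Phi>)"
| Pi_pos: "\<not> ord_zero \<alpha> \<Longrightarrow>
    \<forall>\<phi> \<in> rcset \<Phi>. \<exists>ys \<psi> \<beta>. \<phi> = alls ys \<psi> \<and> \<beta> < \<alpha> \<and> Sigma_fm L \<beta> \<psi> \<Longrightarrow>
    Pi_fm L \<alpha> (Conj \<Phi>)"

text \<open>The classes $\mathfrak{A}_\alpha$, $\mathfrak{E}_\alpha$, $\overline{\mathfrak{A}}_\alpha$,
  $\overline{\mathfrak{E}}_\alpha$ for $\alpha \ge 1$ (there are no formulas in them for
  $\alpha = 0$). The definition is stratified by the ordinal, so the simultaneous least fixed
  point agrees with the closures taken by recursion on the ordinal.\<close>

inductive A_fm E_fm Abar_fm Ebar_fm :: "'r language \<Rightarrow> 'o::wellorder \<Rightarrow> 'r fm \<Rightarrow> bool"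
  for L where
  A_one: "ord_one \<alpha> \<Longrightarrow> Pi_fm L \<alpha> \<phi> \<Longrightarrow> A_fm L \<alpha> \<phi>"
| A_lower: "\<not> ord_zero \<beta> \<Longrightarrow> \<beta> < \<alpha> \<Longrightarrow> Ebar_fm L \<beta> \<phi> \<Longrightarrow> A_fm L \<alpha> \<phi>"
| A_All: "ord_gt_one \<alpha> \<Longrightarrow> A_fm L \<alpha> \<phi> \<Longrightarrow> A_fm L \<alpha> (All x \<phi>)"
| A_Conj: "ord_gt_one \<alpha> \<Longrightarrow> \<forall>\<phi> \<in> rcset \<Phi>. A_fm L \<alpha> \<phi> \<Longrightarrow> A_fm L \<alpha> (Conj \<Phi>)"
| E_one: "ord_one \<alpha> \<Longrightarrow> Sigma_fm L \<alpha> \<phi> \<Longrightarrow> E_fm L \<alpha> \<phi>"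
| E_lower: "\<not> ord_zero \<beta> \<Longrightarrow> \<beta> < \<alpha> \<Longrightarrow> Abar_fm L \<beta> \<phi> \<Longrightarrow> E_fm L \<alpha> \<phi>"
| E_Ex: "ord_gt_one \<alpha> \<Longrightarrow> E_fm L \<alpha> \<phi> \<Longrightarrow> E_fm L \<alpha> (Ex x \<phi>)"
| E_Disj: "ord_gt_one \<alpha> \<Longrightarrow> \<forall>\<phi> \<in> rcset \<Phi>. E_fm L \<alpha> \<phi> \<Longrightarrow> E_fm L \<alpha> (Disj \<Phi>)"
| Abar_base: "A_fm L \<alpha> \<phi> \<Longrightarrow> Abar_fm L \<alpha> \<phi>"
| Abar_Conj: "\<not> ord_zero \<alpha> \<Longrightarrow> \<forall>\<phi> \<in> rcset \<Phi>. Abar_fm L \<alpha> \<phi> \<Longrightarrow> Abar_fm L \<alpha> (Conj \<Phi>)"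
| Abar_Disj: "\<not> ord_zero \<alpha> \<Longrightarrow> \<forall>\<phi> \<in> rcset \<Phi>. Abar_fm L \<alpha> \<phi> \<Longrightarrow> Abar_fm L \<alpha> (Disj \<Phi>)"
| Ebar_base: "E_fm L \<alpha> \<phi> \<Longrightarrow> Ebar_fm L \<alpha> \<phi>"
| Ebar_Conj: "\<not> ord_zero \<alpha> \<Longrightarrow> \<forall>\<phi> \<in> rcset \<Phi>. Ebar_fm L \<alpha> \<phi> \<Longrightarrow> Ebar_fm L \<alpha> (Conj \<Phi>)"
| Ebar_Disj: "\<not> ord_zero \<alpha> \<Longrightarrow> \<forall>\<phi> \<in> rcset \<Phi>. Ebar_fm L \<alpha> \<phi> \<Longrightarrow> Ebar_fm L \<alpha> (Disj \<Phi>)"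

definition forall_E_sentence :: "'r language \<Rightarrow> 'o::wellorder \<Rightarrow> 'r fm \<Rightarrow> bool" where
  "forall_E_sentence L \<alpha> \<chi> \<longleftrightarrow>
     (\<exists>(xs :: nat \<Rightarrow> nat list) \<phi>.
        (\<forall>i. E_fm L \<alpha> (\<phi> i) \<and> fv (\<phi> i) \<subseteq> set (xs i)) \<and>
        \<chi> = Conj (acset (range (\<lambda>i. alls (xs i) (\<phi> i)))))"

definition Pi_type :: "'r language \<Rightarrow> 'o::wellorder \<Rightarrow> nat list \<Rightarrow> 'r fm set \<Rightarrow> bool" where
  "Pi_type L \<alpha> xs \<Gamma> \<longleftrightarrow>
     distinct xs \<and> (\<forall>\<gamma> \<in> \<Gamma>. Pi_fm L \<alpha> \<gamma> \<and> fv \<gamma> \<subseteq> set xs)"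

definition Sigma_supported ::
  "'r language \<Rightarrow> 'o::wellorder \<Rightarrow> ('a, 'r) fo_struct \<Rightarrow> nat list \<Rightarrow> 'r fm set \<Rightarrow> bool" where
  "Sigma_supported L \<alpha> M xs \<Gamma> \<longleftrightarrow>
     (\<exists>\<theta>. Sigma_fm L \<alpha> \<theta> \<and> fv \<theta> \<subseteq> set xs \<and>
        (\<exists>as \<in> tuples M (length xs). sat_tuple M xs \<theta> as) \<and>
        (\<forall>as \<in> tuples M (length xs).
           sat_tuple M xs \<theta> as \<longrightarrow> (\<forall>\<gamma> \<in> \<Gamma>. sat_tuple M xs \<gamma> as)))"

definition omits :: "('a, 'r) fo_struct \<Rightarrow> nat list \<Rightarrow> 'r fm set \<Rightarrow> bool" where
  "omits M xs \<Gamma> \<longleftrightarrow>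
     \<not> (\<exists>as \<in> tuples M (length xs). \<forall>\<gamma> \<in> \<Gamma>. sat_tuple M xs \<gamma> as)"

end

theory Submission
  imports Defs
begin

text \<open>
  Since $M$ is countable, the sets of assignments into $M$ that are $\Sigma_\alpha$-definable with
  finitely many free variables are the open sets of a topology. Nonempty open sets serve as forcing
  conditions, the variables themselves naming the elements of the structure $N$ read off from a
  sufficiently generic decreasing sequence of conditions. In $M$ every subformula of an
  $\mathfrak{E}_\alpha$ formula defines an open set, because an infinite disjunction inside a
  conjunction can be resolved separately at each of the countably many tuples. By genericity, a
  formula all of whose subformulas define open sets holds in $N$ as soon as some condition of the
  sequence is contained in the set that it defines; this gives $N \models \chi$. The image of a
  condition on a finite tuple of variables is open, hence does not support a type $\Gamma_i$, so the
  condition can be shrunk into the negation of some formula of $\Gamma_i$. Only the formulas of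
  $\Gamma_i$ chosen as witnesses of failure at the countably many tuples of $M$ are needed for this,
  so countably many requirements suffice even when $\Gamma_i$ is uncountable.
\<close>

section \<open>Formulas\<close>

text \<open>Satisfaction in \<open>N\<close> is controlled in one direction only: what is forced is
  true. The converse would require a condition to single out a failing conjunct or instance, and the
  set on which it fails need not be open. One direction suffices because both goals say that
  something holds: for a type, that at every tuple some \<open>neg \<gamma>\<close>, a \<Sigma>
  formula of level \<open>\<alpha>\<close>, holds; for the sentence, that each matrix holds at every
  tuple. The quantifiers in front of the matrices are never forced: the matrices hold at every
  assignment into \<open>M\<close>, hence under every naming at every stage. The obstacle on the
  side of definability is that the syntactic classes are closed under renaming and finite
  conjunction only up to equivalence. Openness is therefore a property of predicates and is tested
  point by point: each point needs a \<Pi> neighbourhood of lower level with finitely many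
  witnesses, and countability of \<open>M\<close> assembles these into one formula.\<close>

lemma rcset_cimage: "rcset (cimage f A) = f ` rcset A"
  by (rule cimage.rep_eq)

lemma sat_Conj_iff: "sat M (Conj \<Phi>) v \<longleftrightarrow> (\<forall>\<phi>\<in>rcset \<Phi>. sat M \<phi> v)"
  by (simp add: rcset_cimage)

lemma sat_Disj_iff: "sat M (Disj \<Phi>) v \<longleftrightarrow> (\<exists>\<phi>\<in>rcset \<Phi>. sat M \<phi> v)"
  by (simp add: rcset_cimage)

lemma fv_Conj: "fv (Conj \<Phi>) = (\<Union>\<phi>\<in>rcset \<Phi>. fv \<phi>)"
  by (simp add: rcset_cimage)

lemma fv_Disj: "fv (Disj \<Phi>) = (\<Union>\<phi>\<in>rcset \<Phi>. fv \<phi>)"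
  by (simp add: rcset_cimage)

declare sat.simps(4,5)[simp del] fv.simps(4,5)[simp del]
declare sat_Conj_iff[simp] sat_Disj_iff[simp] fv_Conj[simp] fv_Disj[simp]

lemma sat_cong: "(\<And>x. x \<in> fv \<phi> \<Longrightarrow> v x = w x) \<Longrightarrow> sat M \<phi> v \<longleftrightarrow> sat M \<phi> w"
proof (induction \<phi> arbitrary: v w)
  case (Neg \<phi>)
  have "sat M \<phi> v = sat M \<phi> w"
    by (rule Neg.IH) (use Neg.prems in auto)
  then show ?case by simp
next
  case (Rel r xs)
  then have "map v xs = map w xs" by simp
  then show ?case by (metis sat.simps(2))
next
  case (Conj \<Phi>)
  have "sat M \<phi> v = sat M \<phi> w" if "\<phi> \<in> rcset \<Phi>" for \<phi>
    using that by (intro Conj.IH Conj.prems) auto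
  then show ?case by simp
next
  case (Disj \<Phi>)
  have "sat M \<phi> v = sat M \<phi> w" if "\<phi> \<in> rcset \<Phi>" for \<phi>
    using that by (intro Disj.IH Disj.prems) auto
  then show ?case by simp
next
  case (Ex x \<phi>)
  have "sat M \<phi> (v(x := a)) = sat M \<phi> (w(x := a))" for a
    by (rule Ex.IH) (use Ex.prems in auto)
  then show ?case by simp
next
  case (All x \<phi>)
  have "sat M \<phi> (v(x := a)) = sat M \<phi> (w(x := a))" for a
    by (rule All.IH) (use All.prems in auto)
  then show ?case by simp
qed auto

lemma fv_exs [simp]: "fv (exs ys \<phi>) = fv \<phi> - set ys"
  by (induction ys) auto

lemma fv_alls [simp]: "fv (alls ys \<phi>) = fv \<phi> - set ys"
  by (induction ys) auto

lemma sat_exs: "sat M (exs ys \<phi>) v \<longleftrightarrow>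
  (\<exists>w. (\<forall>x. x \<notin> set ys \<longrightarrow> w x = v x) \<and> (\<forall>x\<in>set ys. w x \<in> carrier M) \<and> sat M \<phi> w)"
proof (induction ys arbitrary: v)
  case Nil
  have "w = v" if "\<forall>x. w x = v x" for w using that by auto
  then show ?case by auto
next
  case (Cons y ys)
  show ?case (is "?l \<longleftrightarrow> ?r")
  proof
    assume ?l
    then obtain a w where "a \<in> carrier M" "\<forall>x. x \<notin> set ys \<longrightarrow> w x = (v(y := a)) x"
      "\<forall>x\<in>set ys. w x \<in> carrier M" "sat M \<phi> w"
      using Cons.IH by auto
    then show ?r by (intro exI[of _ w]) (auto split: if_splits)
  next
    assume ?r
    then obtain w where w: "\<forall>x. x \<notin> set (y # ys) \<longrightarrow> w x = v x"
      "\<forall>x\<in>set (y # ys). w x \<in> carrier M" "sat M \<phi> w" by blast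
    then have "sat M (exs ys \<phi>) (v(y := w y))"
      unfolding Cons.IH by (intro exI[of _ w]) auto
    then show ?l using w by auto
  qed
qed

text \<open>Prefixing \<open>Neg\<close> would leave the inductive classes; the dual formula
  exchanges \<open>Sigma_fm\<close> and \<open>Pi_fm\<close> literally. Stopping at atoms and at
  \<open>Neg\<close> suffices, since in these classes \<open>Neg\<close> occurs only in
  quantifier-free formulas.\<close>

primrec neg :: "'r fm \<Rightarrow> 'r fm" where
  "neg (Eq x y) = Neg (Eq x y)"
| "neg (Rel r xs) = Neg (Rel r xs)"
| "neg (Neg \<phi>) = Neg (Neg \<phi>)"
| "neg (Conj \<Phi>) = Disj (cimage neg \<Phi>)"
| "neg (Disj \<Phi>) = Conj (cimage neg \<Phi>)"
| "neg (Ex x \<phi>) = All x (neg \<phi>)"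
| "neg (All x \<phi>) = Ex x (neg \<phi>)"

lemma sat_neg [simp]: "sat M (neg \<phi>) v \<longleftrightarrow> \<not> sat M \<phi> v"
  by (induction \<phi> arbitrary: v) (auto simp: rcset_cimage)

lemma fv_neg [simp]: "fv (neg \<phi>) = fv \<phi>"
  by (induction \<phi>) (auto simp: rcset_cimage)

lemma neg_exs [simp]: "neg (exs ys \<phi>) = alls ys (neg \<phi>)"
  by (induction ys) auto

lemma neg_alls [simp]: "neg (alls ys \<phi>) = exs ys (neg \<phi>)"
  by (induction ys) auto

lemma sat_alls: "sat M (alls ys \<phi>) v \<longleftrightarrow>
  (\<forall>w. (\<forall>x. x \<notin> set ys \<longrightarrow> w x = v x) \<longrightarrow> (\<forall>x\<in>set ys. w x \<in> carrier M) \<longrightarrow> sat M \<phi> w)"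
proof -
  have "sat M (alls ys \<phi>) v \<longleftrightarrow> \<not> sat M (exs ys (neg \<phi>)) v"
    by (metis neg_alls sat_neg)
  then show ?thesis unfolding sat_exs sat_neg by blast
qed

lemma qf_fm_neg: "qf_fm L \<phi> \<Longrightarrow> qf_fm L (neg \<phi>)"
  by (induction rule: qf_fm.induct) (auto simp: rcset_cimage intro!: qf_fm.intros)

lemma Pi_fm_neg: "Sigma_fm L \<alpha> \<phi> \<Longrightarrow> Pi_fm L \<alpha> (neg \<phi>)"
  and Sigma_fm_neg: "Pi_fm L \<alpha> \<phi> \<Longrightarrow> Sigma_fm L \<alpha> (neg \<phi>)"
proof (induction rule: Sigma_fm_Pi_fm.inducts)
  case (Sigma_pos \<alpha> \<Phi>)
  show ?case
    unfolding neg.simps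
    by (rule Sigma_fm_Pi_fm.Pi_pos) (use Sigma_pos in \<open>fastforce simp: rcset_cimage\<close>)+
next
  case (Pi_pos \<alpha> \<Phi>)
  show ?case
    unfolding neg.simps
    by (rule Sigma_fm_Pi_fm.Sigma_pos) (use Pi_pos in \<open>fastforce simp: rcset_cimage\<close>)+
qed (auto intro: Sigma_fm_Pi_fm.intros qf_fm_neg)

primrec subfms :: "'r fm \<Rightarrow> 'r fm set" where
  "subfms (Eq x y) = {Eq x y}"
| "subfms (Rel r xs) = {Rel r xs}"
| "subfms (Neg \<phi>) = insert (Neg \<phi>) (subfms \<phi>)"
| "subfms (Conj \<Phi>) = insert (Conj \<Phi>) (\<Union> (rcset (cimage subfms \<Phi>)))"
| "subfms (Disj \<Phi>) = insert (Disj \<Phi>) (\<Union> (rcset (cimage subfms \<Phi>)))"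
| "subfms (Ex x \<phi>) = insert (Ex x \<phi>) (subfms \<phi>)"
| "subfms (All x \<phi>) = insert (All x \<phi>) (subfms \<phi>)"

lemma subfms_refl: "\<phi> \<in> subfms \<phi>"
  by (cases \<phi>) auto

lemma subfms_trans: "\<psi> \<in> subfms \<phi> \<Longrightarrow> subfms \<psi> \<subseteq> subfms \<phi>"
  by (induction \<phi>) (auto simp: rcset_cimage)

lemma countable_subfms: "countable (subfms \<phi>)"
  by (induction \<phi>) (auto simp: rcset_cimage)

section \<open>Definable sets in a countable structure\<close>

locale countable_structure =
  fixes L :: "'r language" and M :: "('a, 'r) fo_struct"
  assumes structure_M: "structure_for L M"
    and countable_carrier: "countable (carrier M)"
begin

definition asg :: "(nat \<Rightarrow> 'a) set" where
  "asg = {v. range v \<subseteq> carrier M}"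

definition Sdef :: "'o::wellorder \<Rightarrow> nat set \<Rightarrow> ((nat \<Rightarrow> 'a) \<Rightarrow> bool) \<Rightarrow> bool" where
  "Sdef \<alpha> D X \<longleftrightarrow>
     (\<exists>\<phi>. Sigma_fm L \<alpha> \<phi> \<and> fv \<phi> \<subseteq> D \<and> (\<forall>v\<in>asg. sat M \<phi> v \<longleftrightarrow> X v))"

text \<open>Defined through the complement, so that each closure property of \<open>Sdef\<close>
  dualises without a second proof.\<close>

definition Pdef :: "'o::wellorder \<Rightarrow> nat set \<Rightarrow> ((nat \<Rightarrow> 'a) \<Rightarrow> bool) \<Rightarrow> bool" where
  "Pdef \<alpha> D X \<longleftrightarrow> Sdef \<alpha> D (\<lambda>v. \<not> X v)"

lemma asg_nonempty: "\<exists>a. a \<in> carrier M"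
  using structure_M by (auto simp: structure_for_def)

lemma asg_app [simp]: "v \<in> asg \<Longrightarrow> v x \<in> carrier M"
  by (auto simp: asg_def)

lemma asgI: "(\<And>x. v x \<in> carrier M) \<Longrightarrow> v \<in> asg"
  by (auto simp: asg_def)

lemma asg_comp [simp]: "v \<in> asg \<Longrightarrow> v \<circ> \<sigma> \<in> asg"
  by (auto simp: asg_def)

lemma Pdef_iff: "Pdef \<alpha> D X \<longleftrightarrow>
  (\<exists>\<phi>. Pi_fm L \<alpha> \<phi> \<and> fv \<phi> \<subseteq> D \<and> (\<forall>v\<in>asg. sat M \<phi> v \<longleftrightarrow> X v))"
proof
  assume "Pdef \<alpha> D X"
  then obtain \<phi> where "Sigma_fm L \<alpha> \<phi>" "fv \<phi> \<subseteq> D" "\<forall>v\<in>asg. sat M \<phi> v \<longleftrightarrow> \<not> X v"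
    by (auto simp: Pdef_def Sdef_def)
  then show "\<exists>\<phi>. Pi_fm L \<alpha> \<phi> \<and> fv \<phi> \<subseteq> D \<and> (\<forall>v\<in>asg. sat M \<phi> v \<longleftrightarrow> X v)"
    by (intro exI[of _ "neg \<phi>"]) (auto intro: Pi_fm_neg)
next
  assume "\<exists>\<phi>. Pi_fm L \<alpha> \<phi> \<and> fv \<phi> \<subseteq> D \<and> (\<forall>v\<in>asg. sat M \<phi> v \<longleftrightarrow> X v)"
  then obtain \<phi> where "Pi_fm L \<alpha> \<phi>" "fv \<phi> \<subseteq> D" "\<forall>v\<in>asg. sat M \<phi> v \<longleftrightarrow> X v"
    by auto
  then show "Pdef \<alpha> D X" unfolding Pdef_def Sdef_def
    by (intro exI[of _ "neg \<phi>"]) (auto intro: Sigma_fm_neg)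
qed

lemma Sdef_mono: "Sdef \<alpha> D X \<Longrightarrow> D \<subseteq> D' \<Longrightarrow> Sdef \<alpha> D' X"
  unfolding Sdef_def by blast

lemma Pdef_mono: "Pdef \<alpha> D X \<Longrightarrow> D \<subseteq> D' \<Longrightarrow> Pdef \<alpha> D' X"
  unfolding Pdef_def by (rule Sdef_mono)

lemma Sdef_cong: "Sdef \<alpha> D X \<Longrightarrow> (\<And>v. v \<in> asg \<Longrightarrow> X v \<longleftrightarrow> Y v) \<Longrightarrow> Sdef \<alpha> D Y"
  unfolding Sdef_def by auto

lemma Pdef_cong: "Pdef \<alpha> D X \<Longrightarrow> (\<And>v. v \<in> asg \<Longrightarrow> X v \<longleftrightarrow> Y v) \<Longrightarrow> Pdef \<alpha> D Y"
  using Sdef_cong[of \<alpha> D "\<lambda>v. \<not> X v" "\<lambda>v. \<not> Y v"] by (auto simp: Pdef_def)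

lemma Sdef_depends:
  assumes "Sdef \<alpha> D X" "v \<in> asg" "w \<in> asg" "\<And>x. x \<in> D \<Longrightarrow> v x = w x"
  shows "X v \<longleftrightarrow> X w"
proof -
  obtain \<phi> where "fv \<phi> \<subseteq> D" "\<forall>v\<in>asg. sat M \<phi> v \<longleftrightarrow> X v"
    using assms by (auto simp: Sdef_def)
  moreover from this have "sat M \<phi> v \<longleftrightarrow> sat M \<phi> w"
    using assms(4) by (intro sat_cong) auto
  ultimately show ?thesis using assms by auto
qed

lemma Pdef_depends:
  assumes "Pdef \<alpha> D X" "v \<in> asg" "w \<in> asg" "\<And>x. x \<in> D \<Longrightarrow> v x = w x"
  shows "X v \<longleftrightarrow> X w"
  using Sdef_depends[of \<alpha> D "\<lambda>v. \<not> X v" v w] assms by (auto simp: Pdef_def)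

section \<open>Local characterisation of definability\<close>

lemma countable_supported_asg:
  assumes "finite D"
  shows "countable {v \<in> asg. \<forall>x. x \<notin> D \<longrightarrow> v x = a}"
proof -
  obtain ds where ds: "set ds = D" "distinct ds"
    using finite_distinct_list[OF assms] by auto
  have "v = (\<lambda>x. case map_of (zip ds (map v ds)) x of None \<Rightarrow> a | Some b \<Rightarrow> b)"
    if "\<forall>x. x \<notin> D \<longrightarrow> v x = a" for v
  proof
    fix x
    show "v x = (case map_of (zip ds (map v ds)) x of None \<Rightarrow> a | Some b \<Rightarrow> b)"
    proof (cases "x \<in> D")
      case True
      then show ?thesis using ds by (simp add: map_of_zip_map)
    next
      case False
      then show ?thesis using ds that by (simp add: map_of_zip_map)
    qed
  qed
  note eq = this
  have "{v \<in> asg. \<forall>x. x \<notin> D \<longrightarrow> v x = a} \<subseteq>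
    (\<lambda>l x. case map_of (zip ds l) x of None \<Rightarrow> a | Some b \<Rightarrow> b) ` lists (carrier M)"
  proof
    fix v assume "v \<in> {v \<in> asg. \<forall>x. x \<notin> D \<longrightarrow> v x = a}"
    then show "v \<in> (\<lambda>l x. case map_of (zip ds l) x of None \<Rightarrow> a | Some b \<Rightarrow> b) ` lists (carrier M)"
      by (intro image_eqI[where x = "map v ds"] eq) auto
  qed
  then show ?thesis
    using countable_lists[OF countable_carrier] by (meson countable_image countable_subset)
qed

text \<open>The parameter \<open>K\<close> is a set of variables that the existential witnesses, living on \<open>E - D\<close>,
  have to avoid; it is what allows two neighbourhoods to be intersected.\<close>

definition locally :: "'o::wellorder \<Rightarrow> nat set \<Rightarrow> nat set \<Rightarrow> ((nat \<Rightarrow> 'a) \<Rightarrow> bool) \<Rightarrow> bool" where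
  "locally \<alpha> K D X \<longleftrightarrow>
     (\<forall>v\<in>asg. \<forall>w\<in>asg. (\<forall>x\<in>D. v x = w x) \<longrightarrow> X v \<longrightarrow> X w) \<and>
     (\<forall>v\<in>asg. X v \<longrightarrow> (\<exists>\<beta><\<alpha>. \<exists>E Y. \<exists>w\<in>asg. finite E \<and> (E - D) \<inter> K = {} \<and> Pdef \<beta> E Y \<and>
        (\<forall>x\<in>D. v x = w x) \<and> Y w \<and> (\<forall>u\<in>asg. Y u \<longrightarrow> X u)))"

lemma locallyI:
  assumes "\<And>v w. v \<in> asg \<Longrightarrow> w \<in> asg \<Longrightarrow> (\<And>x. x \<in> D \<Longrightarrow> v x = w x) \<Longrightarrow> X v \<Longrightarrow> X w"
    and "\<And>v. v \<in> asg \<Longrightarrow> X v \<Longrightarrow> \<exists>\<beta><\<alpha>. \<exists>E Y. \<exists>w\<in>asg. finite E \<and> (E - D) \<inter> K = {} \<and>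
      Pdef \<beta> E Y \<and> (\<forall>x\<in>D. v x = w x) \<and> Y w \<and> (\<forall>u\<in>asg. Y u \<longrightarrow> X u)"
  shows "locally \<alpha> K D X"
  using assms unfolding locally_def by blast

lemma locallyE:
  assumes "locally \<alpha> K D X" "v \<in> asg" "X v"
  obtains \<beta> E Y w where "\<beta> < \<alpha>" "finite E" "(E - D) \<inter> K = {}" "Pdef \<beta> E Y" "w \<in> asg"
    "\<And>x. x \<in> D \<Longrightarrow> v x = w x" "Y w" "\<And>u. u \<in> asg \<Longrightarrow> Y u \<Longrightarrow> X u"
  using assms(1)[unfolded locally_def, THEN conjunct2, rule_format, OF assms(2,3)]
  by (elim exE conjE bexE) (rule that, assumption+, auto)

lemma locally_depends:
  assumes "locally \<alpha> K D X" "X v" "v \<in> asg" "w \<in> asg" "\<And>x. x \<in> D \<Longrightarrow> v x = w x"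
  shows "X w"
  using assms(1)[unfolded locally_def, THEN conjunct1, rule_format, OF assms(3,4) _ assms(2)] assms(5)
  by simp

text \<open>The defining disjunction has one neighbourhood for each of countably many
  representatives; the witnesses in \<open>E - D\<close> become the existential block of a
  disjunct.\<close>

lemma Sdef_if_locally:
  assumes "locally \<alpha> K D X" "\<not> ord_zero \<alpha>" "finite D"
  shows "Sdef \<alpha> D X"
proof -
  obtain a where a: "a \<in> carrier M" using asg_nonempty by auto
  \<comment> \<open>The default \<open>a\<close> off \<open>D\<close> picks one representative from
    each class of assignments agreeing on \<open>D\<close>; \<open>asg\<close> itself may be
    uncountable.\<close>
  define W where "W = {v \<in> asg. X v \<and> (\<forall>x. x \<notin> D \<longrightarrow> v x = a)}"
  have cW: "countable W"
    by (rule countable_subset[OF _ countable_supported_asg[OF assms(3), of a]]) (auto simp: W_def)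
  have "\<exists>\<phi>. (\<exists>ys \<psi> \<beta>. \<phi> = exs ys \<psi> \<and> \<beta> < \<alpha> \<and> Pi_fm L \<beta> \<psi>) \<and> fv \<phi> \<subseteq> D \<and>
          sat M \<phi> v \<and> (\<forall>u\<in>asg. sat M \<phi> u \<longrightarrow> X u)" if v: "v \<in> W" for v
  proof -
    have v': "v \<in> asg" "X v" using v by (auto simp: W_def)
    from locallyE[OF assms(1) this] obtain \<beta> E Y w where *: "\<beta> < \<alpha>" "finite E" "Pdef \<beta> E Y"
      "w \<in> asg" "\<And>x. x \<in> D \<Longrightarrow> v x = w x" "Y w" "\<And>u. u \<in> asg \<Longrightarrow> Y u \<Longrightarrow> X u"
      by metis
    from *(3) obtain \<psi> where \<psi>: "Pi_fm L \<beta> \<psi>" "fv \<psi> \<subseteq> E" "\<And>v. v \<in> asg \<Longrightarrow> sat M \<psi> v \<longleftrightarrow> Y v"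
      unfolding Pdef_iff by auto
    obtain ys where ys: "set ys = E - D"
      using finite_list[of "E - D"] *(2) by auto
    have "sat M (exs ys \<psi>) v"
      unfolding sat_exs
    \<comment> \<open>Only variables in \<open>E - D\<close> may change, so \<open>w\<close> is
      replaced by \<open>v\<close> outside \<open>E\<close>; on \<open>D\<close> the two agree
      anyway.\<close>
    proof (intro exI[of _ "\<lambda>x. if x \<in> E then w x else v x"] conjI)
      have "sat M \<psi> (\<lambda>x. if x \<in> E then w x else v x) \<longleftrightarrow> sat M \<psi> w"
        by (rule sat_cong) (use \<psi> in auto)
      then show "sat M \<psi> (\<lambda>x. if x \<in> E then w x else v x)" using \<psi>(3) * by auto
    qed (use * ys v' in auto)
    moreover have "X u" if u: "u \<in> asg" "sat M (exs ys \<psi>) u" for u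
    proof -
      obtain t where t: "\<And>x. x \<notin> set ys \<Longrightarrow> t x = u x" "\<And>x. x \<in> set ys \<Longrightarrow> t x \<in> carrier M"
        "sat M \<psi> t"
        using u(2) unfolding sat_exs by blast
      have ta: "t \<in> asg" using t(1,2) u(1) by (metis asgI asg_app)
      then have "X t" using t(3) \<psi>(3) *(7) by auto
      then show ?thesis by (rule locally_depends[OF assms(1)]) (use t(1) ys ta u in auto)
    qed
    ultimately show ?thesis
      using * \<psi> ys by (intro exI[of _ "exs ys \<psi>"]) auto
  qed
  then obtain f where f: "\<And>v. v \<in> W \<Longrightarrow> \<exists>ys \<psi> \<beta>. f v = exs ys \<psi> \<and> \<beta> < \<alpha> \<and> Pi_fm L \<beta> \<psi>"
    "\<And>v. v \<in> W \<Longrightarrow> fv (f v) \<subseteq> D" "\<And>v. v \<in> W \<Longrightarrow> sat M (f v) v"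
    "\<And>v u. v \<in> W \<Longrightarrow> u \<in> asg \<Longrightarrow> sat M (f v) u \<Longrightarrow> X u"
    by metis
  define \<theta> where "\<theta> = Disj (acset (f ` W))"
  have rc: "rcset (acset (f ` W)) = f ` W"
    using cW by simp
  have "Sigma_fm L \<alpha> \<theta>"
    unfolding \<theta>_def using f(1) by (intro Sigma_fm_Pi_fm.Sigma_pos assms) (auto simp: rc)
  moreover have "fv \<theta> \<subseteq> D"
    using f(2) by (auto simp: \<theta>_def rc)
  moreover have "sat M \<theta> v \<longleftrightarrow> X v" if v: "v \<in> asg" for v
  proof
    assume "sat M \<theta> v"
    then show "X v" using f(4) v by (auto simp: \<theta>_def rc)
  next
    assume X: "X v"
    define w where "w x = (if x \<in> D then v x else a)" for x
    have "w \<in> asg" using v a by (auto intro: asgI simp: w_def)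
    moreover have "X w"
      by (rule locally_depends[OF assms(1) X v \<open>w \<in> asg\<close>]) (simp add: w_def)
    ultimately have "w \<in> W" by (auto simp: W_def w_def)
    then have "sat M (f w) w" by (rule f(3))
    also have "sat M (f w) w \<longleftrightarrow> sat M (f w) v"
      using f(2)[OF \<open>w \<in> W\<close>] by (intro sat_cong) (auto simp: w_def)
    finally show "sat M \<theta> v" using \<open>w \<in> W\<close> by (auto simp: \<theta>_def rc)
  qed
  ultimately show ?thesis unfolding Sdef_def by auto
qed

section \<open>Renaming of variables\<close>

lemma qf_rename:
  "qf_fm L \<phi> \<Longrightarrow> \<exists>\<phi>'. qf_fm L \<phi>' \<and> fv \<phi>' \<subseteq> \<sigma> ` fv \<phi> \<and> (\<forall>v. sat M \<phi>' v \<longleftrightarrow> sat M \<phi> (v \<circ> \<sigma>))"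
proof (induction rule: qf_fm.induct)
  case (qf_Eq x y)
  then show ?case by (intro exI[of _ "Eq (\<sigma> x) (\<sigma> y)"]) (auto intro: qf_fm.intros)
next
  case (qf_Rel r xs)
  then show ?case by (intro exI[of _ "Rel r (map \<sigma> xs)"]) (auto intro: qf_fm.intros simp: comp_def)
next
  case (qf_Neg \<phi>)
  then obtain \<phi>' where "qf_fm L \<phi>'" "fv \<phi>' \<subseteq> \<sigma> ` fv \<phi>"
    "\<And>v. sat M \<phi>' v \<longleftrightarrow> sat M \<phi> (v \<circ> \<sigma>)" by blast
  then show ?case by (intro exI[of _ "Neg \<phi>'"]) (auto intro: qf_fm.intros simp: comp_def)
next
  case (qf_Conj \<Phi>)
  then obtain f where f: "\<forall>\<phi>\<in>rcset \<Phi>. qf_fm L (f \<phi>) \<and> fv (f \<phi>) \<subseteq> \<sigma> ` fv \<phi> \<and>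
     (\<forall>v. sat M (f \<phi>) v \<longleftrightarrow> sat M \<phi> (v \<circ> \<sigma>))" by metis
  have "qf_fm L (Conj (cimage f \<Phi>))"
    using f qf_Conj(1) by (intro qf_fm.qf_Conj) (auto simp: rcset_cimage)
  moreover have "fv (Conj (cimage f \<Phi>)) \<subseteq> \<sigma> ` fv (Conj \<Phi>)"
    using f by (fastforce simp: rcset_cimage)
  moreover have "sat M (Conj (cimage f \<Phi>)) v \<longleftrightarrow> sat M (Conj \<Phi>) (v \<circ> \<sigma>)" for v
    using f by (simp add: rcset_cimage)
  ultimately show ?case by blast
next
  case (qf_Disj \<Phi>)
  then obtain f where f: "\<forall>\<phi>\<in>rcset \<Phi>. qf_fm L (f \<phi>) \<and> fv (f \<phi>) \<subseteq> \<sigma> ` fv \<phi> \<and>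
     (\<forall>v. sat M (f \<phi>) v \<longleftrightarrow> sat M \<phi> (v \<circ> \<sigma>))" by metis
  have "qf_fm L (Disj (cimage f \<Phi>))"
    using f qf_Disj(1) by (intro qf_fm.qf_Disj) (auto simp: rcset_cimage)
  moreover have "fv (Disj (cimage f \<Phi>)) \<subseteq> \<sigma> ` fv (Disj \<Phi>)"
    using f by (fastforce simp: rcset_cimage)
  moreover have "sat M (Disj (cimage f \<Phi>)) v \<longleftrightarrow> sat M (Disj \<Phi>) (v \<circ> \<sigma>)" for v
    using f by (simp add: rcset_cimage)
  ultimately show ?case by blast
qed

lemma Sigma_fm_zero_iff: "ord_zero \<alpha> \<Longrightarrow> Sigma_fm L \<alpha> \<phi> \<longleftrightarrow> qf_fm L \<phi>"
  by (metis Sigma_fm.cases Sigma_zero)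

lemma Sigma_fm_posE:
  assumes "Sigma_fm L \<alpha> \<theta>" "\<not> ord_zero \<alpha>"
  obtains \<Phi> where "\<theta> = Disj \<Phi>"
    "\<And>\<phi>. \<phi> \<in> rcset \<Phi> \<Longrightarrow> \<exists>ys \<psi> \<beta>. \<phi> = exs ys \<psi> \<and> \<beta> < \<alpha> \<and> Pi_fm L \<beta> \<psi>"
  using assms(1)
proof (cases rule: Sigma_fm.cases)
  case (Sigma_pos \<Phi>)
  then show thesis using that by blast
qed (use assms(2) in blast)

text \<open>Locality at level \<open>\<alpha>\<close> renames variables in a matrix of lower level;
  renaming at level \<open>\<alpha>\<close> in turn goes through locality. One induction proves
  both, here with renaming below \<open>\<alpha>\<close> as hypothesis.\<close>

lemma locally_if_Sdef_aux:
  fixes \<alpha> :: "'o::wellorder"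
  assumes IH: "\<And>\<beta> D X \<sigma>. (\<beta>::'o) < \<alpha> \<Longrightarrow> finite D \<Longrightarrow> Sdef \<beta> D X \<Longrightarrow> Sdef \<beta> (\<sigma> ` D) (\<lambda>v. X (v \<circ> \<sigma>))"
    and S: "Sdef \<alpha> D X" and "\<not> ord_zero \<alpha>" and fin: "finite D" "finite K"
  shows "locally \<alpha> K D X"
proof (rule locallyI)
  show "X w" if "v \<in> asg" "w \<in> asg" "\<And>x. x \<in> D \<Longrightarrow> v x = w x" "X v" for v w
    using Sdef_depends[OF S] that by blast
next
  fix v assume v: "v \<in> asg" "X v"
  obtain \<theta> where \<theta>: "Sigma_fm L \<alpha> \<theta>" "fv \<theta> \<subseteq> D" "\<And>v. v \<in> asg \<Longrightarrow> sat M \<theta> v \<longleftrightarrow> X v"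
    using S by (auto simp: Sdef_def)
  obtain \<Phi> where \<Phi>: "\<theta> = Disj \<Phi>"
    "\<And>\<phi>. \<phi> \<in> rcset \<Phi> \<Longrightarrow> \<exists>ys \<psi> \<beta>. \<phi> = exs ys \<psi> \<and> \<beta> < \<alpha> \<and> Pi_fm L \<beta> \<psi>"
    using Sigma_fm_posE[OF \<theta>(1) assms(3)] by metis
  have "sat M \<theta> v" using v \<theta>(3) by auto
  then obtain ys \<psi> \<beta> where \<psi>: "exs ys \<psi> \<in> rcset \<Phi>" "\<beta> < \<alpha>" "Pi_fm L \<beta> \<psi>" "sat M (exs ys \<psi>) v"
    using \<Phi> by (auto simp del: fv_exs) metis
  have "fv (exs ys \<psi>) \<subseteq> D" using \<psi>(1) \<theta>(2) \<Phi>(1) by (auto simp del: fv_exs)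
  then have fv: "fv \<psi> \<subseteq> D \<union> set ys" by auto
  then have fin\<psi>: "finite (fv \<psi>)" using fin finite_subset by blast
  obtain w where w: "\<And>x. x \<notin> set ys \<Longrightarrow> w x = v x" "\<And>x. x \<in> set ys \<Longrightarrow> w x \<in> carrier M" "sat M \<psi> w"
    using \<psi>(4) unfolding sat_exs by blast
  \<comment> \<open>Shifting by a bound \<open>N\<close> of \<open>D\<close> and \<open>K\<close>
    makes the witnesses fresh. A quantified variable that also lies in \<open>D\<close> is shifted
    too, which keeps its bound value apart from its value under \<open>v\<close>.\<close>
  obtain N where N: "\<And>x. x \<in> D \<union> K \<Longrightarrow> x < N"
    using finite_nat_set_iff_bounded[of "D \<union> K"] fin by auto
  define \<tau> where "\<tau> x = (if x \<in> set ys then x + N else x)" for x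
  define E where "E = \<tau> ` fv \<psi>"
  define Y where "Y u = sat M \<psi> (u \<circ> \<tau>)" for u
  define w' where "w' x = (if N \<le> x \<and> x - N \<in> set ys then w (x - N) else v x)" for x
  have "Pdef \<beta> (fv \<psi>) (sat M \<psi>)"
    unfolding Pdef_iff using \<psi>(3) by blast
  then have "Sdef \<beta> E (\<lambda>v. \<not> sat M \<psi> (v \<circ> \<tau>))"
    unfolding Pdef_def E_def by (intro IH[OF \<psi>(2) fin\<psi>, of "\<lambda>v. \<not> sat M \<psi> v"])
  then have P: "Pdef \<beta> E Y"
    unfolding Pdef_def Y_def .
  have "w' \<in> asg" using v w by (auto intro!: asgI simp: w'_def)
  moreover have "\<forall>x\<in>D. v x = w' x" using N by (force simp: w'_def)
  moreover have "Y w'"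
  proof -
    have "(w' \<circ> \<tau>) x = w x" if "x \<in> fv \<psi>" for x
    proof (cases "x \<in> set ys")
      case False
      then have "x \<in> D" using fv that by auto
      then have "x < N" using N by auto
      then show ?thesis using False w(1) by (auto simp: w'_def \<tau>_def)
    qed (simp add: w'_def \<tau>_def)
    then have "sat M \<psi> (w' \<circ> \<tau>) \<longleftrightarrow> sat M \<psi> w" by (rule sat_cong)
    then show ?thesis using w(3) by (simp add: Y_def)
  qed
  moreover have "X u" if u: "u \<in> asg" "Y u" for u
  proof -
    have "sat M (exs ys \<psi>) u"
      unfolding sat_exs using u by (intro exI[of _ "u \<circ> \<tau>"]) (auto simp: Y_def \<tau>_def)
    then have "sat M \<theta> u" using \<psi>(1) \<Phi>(1) by auto
    then show ?thesis using \<theta>(3) u(1) by auto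
  qed
  moreover have "finite E" using fin\<psi> by (auto simp: E_def)
  moreover have "(E - D) \<inter> K = {}"
  proof -
    have "\<tau> x \<in> D \<or> N \<le> \<tau> x" if "x \<in> fv \<psi>" for x
      using that fv by (auto simp: \<tau>_def)
    then show ?thesis using N by (force simp: E_def)
  qed
  ultimately show "\<exists>\<beta><\<alpha>. \<exists>E Y. \<exists>w\<in>asg. finite E \<and> (E - D) \<inter> K = {} \<and>
      Pdef \<beta> E Y \<and> (\<forall>x\<in>D. v x = w x) \<and> Y w \<and> (\<forall>u\<in>asg. Y u \<longrightarrow> X u)"
    using P \<psi>(2) by blast
qed

text \<open>\<open>\<sigma>\<close> may identify variables. At positive levels the neighbourhoods of
  \<open>v \<circ> \<sigma>\<close>, which have lower level, are renamed by induction and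
  reassembled.\<close>

lemma Sdef_rename:
  "finite D \<Longrightarrow> Sdef \<alpha> D X \<Longrightarrow> Sdef \<alpha> (\<sigma> ` D) (\<lambda>v. X (v \<circ> \<sigma>))"
proof (induction \<alpha> arbitrary: D X \<sigma> rule: less_induct)
  case (less \<alpha>)
  show ?case
  proof (cases "ord_zero \<alpha>")
    case True
    obtain \<phi> where \<phi>: "qf_fm L \<phi>" "fv \<phi> \<subseteq> D" "\<forall>v\<in>asg. sat M \<phi> v \<longleftrightarrow> X v"
      using less.prems(2) by (auto simp: Sdef_def Sigma_fm_zero_iff[OF True])
    obtain \<phi>' where "qf_fm L \<phi>'" "fv \<phi>' \<subseteq> \<sigma> ` fv \<phi>" "\<forall>v. sat M \<phi>' v \<longleftrightarrow> sat M \<phi> (v \<circ> \<sigma>)"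
      using qf_rename[OF \<phi>(1)] by blast
    then show ?thesis
      unfolding Sdef_def Sigma_fm_zero_iff[OF True] using \<phi>
      by (intro exI[of _ \<phi>']) (auto; blast)
  next
    case False
    \<comment> \<open>Witnesses are kept off the image of \<open>D\<close> under
      \<open>\<sigma>\<close>, so that \<open>\<tau>\<close> below can move \<open>D\<close> by
      \<open>\<sigma>\<close> and fix the witnesses without a clash.\<close>
    have loc: "locally \<alpha> (\<sigma> ` D) D X"
      by (rule locally_if_Sdef_aux[OF less.IH less.prems(2) False less.prems(1)])
        (use less.prems(1) in auto)
    have dep: "X v \<longleftrightarrow> X w" if "v \<in> asg" "w \<in> asg" "\<And>x. x \<in> D \<Longrightarrow> v x = w x" for v w
      using Sdef_depends[OF less.prems(2)] that by blast
    have "locally \<alpha> {} (\<sigma> ` D) (\<lambda>v. X (v \<circ> \<sigma>))"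
    proof (rule locallyI)
      show "X (w \<circ> \<sigma>)" if "v \<in> asg" "w \<in> asg" "\<And>x. x \<in> \<sigma> ` D \<Longrightarrow> v x = w x" "X (v \<circ> \<sigma>)" for v w
        using dep[of "v \<circ> \<sigma>" "w \<circ> \<sigma>"] that by auto
    next
      fix v assume v: "v \<in> asg" "X (v \<circ> \<sigma>)"
      from locallyE[OF loc asg_comp[OF v(1)] v(2)]
      obtain \<beta> E Y w where *: "\<beta> < \<alpha>" "finite E" "(E - D) \<inter> \<sigma> ` D = {}" "Pdef \<beta> E Y"
        "w \<in> asg" "\<And>x. x \<in> D \<Longrightarrow> (v \<circ> \<sigma>) x = w x" "Y w" "\<And>u. u \<in> asg \<Longrightarrow> Y u \<Longrightarrow> X u"
        by metis
      define \<tau> where "\<tau> x = (if x \<in> D then \<sigma> x else x)" for x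
      define w' where "w' x = (if x \<in> E - D then w x else v x)" for x
      have "Pdef \<beta> (\<tau> ` E) (\<lambda>u. Y (u \<circ> \<tau>))"
        using less.IH[OF *(1,2), of "\<lambda>u. \<not> Y u" \<tau>] *(4) unfolding Pdef_def by blast
      moreover have w'a: "w' \<in> asg" using v * by (auto intro!: asgI simp: w'_def)
      moreover have "Y (w' \<circ> \<tau>)"
      proof -
        have "(w' \<circ> \<tau>) x = w x" if "x \<in> E" for x
          using that *(3,6) by (auto simp: w'_def \<tau>_def)
        then have "Y (w' \<circ> \<tau>) \<longleftrightarrow> Y w"
          by (intro Pdef_depends[OF *(4)]) (use *(5) w'a in auto)
        then show ?thesis using * by auto
      qed
      moreover have "X (u \<circ> \<sigma>)" if "u \<in> asg" "Y (u \<circ> \<tau>)" for u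
      proof -
        have "X (u \<circ> \<tau>)" using *(8) that by auto
        moreover have "X (u \<circ> \<tau>) \<longleftrightarrow> X (u \<circ> \<sigma>)"
          using that by (intro dep) (auto simp: \<tau>_def)
        ultimately show ?thesis by auto
      qed
      moreover have "\<forall>x\<in>\<sigma> ` D. v x = w' x" using *(3) by (auto simp: w'_def)
      ultimately show "\<exists>\<beta><\<alpha>. \<exists>E Y. \<exists>w\<in>asg. finite E \<and> (E - \<sigma> ` D) \<inter> {} = {} \<and>
          Pdef \<beta> E Y \<and> (\<forall>x\<in>\<sigma> ` D. v x = w x) \<and> Y w \<and> (\<forall>u\<in>asg. Y u \<longrightarrow> X (u \<circ> \<sigma>))"
        using *(1,2) by (intro exI[of _ \<beta>] conjI exI[of _ "\<tau> ` E"] exI[of _ "\<lambda>u. Y (u \<circ> \<tau>)"] bexI[of _ w']) auto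
    qed
    then show ?thesis by (rule Sdef_if_locally) (use False less.prems(1) in auto)
  qed
qed

section \<open>Closure properties of definable sets\<close>

lemma locally_if_Sdef:
  fixes \<alpha> :: "'o::wellorder"
  assumes "Sdef \<alpha> D X" "\<not> ord_zero \<alpha>" "finite D" "finite K"
  shows "locally \<alpha> K D X"
proof -
  have "Sdef \<beta> (\<sigma> ` D) (\<lambda>v. X (v \<circ> \<sigma>))" if "finite D" "Sdef \<beta> D X"
    for \<beta> :: 'o and D X \<sigma> using that by (rule Sdef_rename)
  then show ?thesis using assms by (rule locally_if_Sdef_aux)
qed

text \<open>The family may have any size: neighbourhoods for its members are neighbourhoods for the
  union, and \<open>Sdef_if_locally\<close> uses only countably many of them.\<close>

lemma Sdef_Union:
  assumes "\<And>X. X \<in> \<X> \<Longrightarrow> Sdef \<alpha> D X" "\<not> ord_zero \<alpha>" "finite D"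
  shows "Sdef \<alpha> D (\<lambda>v. \<exists>X\<in>\<X>. X v)"
proof -
  have loc: "locally \<alpha> {} D X" if "X \<in> \<X>" for X
    using assms that by (intro locally_if_Sdef) auto
  have "locally \<alpha> {} D (\<lambda>v. \<exists>X\<in>\<X>. X v)"
  proof (rule locallyI)
    fix v w assume vw: "v \<in> asg" "w \<in> asg" "\<And>x. x \<in> D \<Longrightarrow> v x = w x" "\<exists>X\<in>\<X>. X v"
    then obtain X where "X \<in> \<X>" "X v" by auto
    then show "\<exists>X\<in>\<X>. X w"
      using Sdef_depends[OF assms(1)[OF \<open>X \<in> \<X>\<close>], of v w] vw by auto
  next
    fix v assume v: "v \<in> asg" "\<exists>X\<in>\<X>. X v"
    then obtain X where X: "X \<in> \<X>" "X v" by auto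
    from locallyE[OF loc[OF X(1)] v(1) X(2)] obtain \<beta> E Y w
      where "\<beta> < \<alpha>" "finite E" "(E - D) \<inter> {} = {}" "Pdef \<beta> E Y" "w \<in> asg"
        "\<And>x. x \<in> D \<Longrightarrow> v x = w x" "Y w" "\<And>u. u \<in> asg \<Longrightarrow> Y u \<Longrightarrow> X u" by metis
    then show "\<exists>\<beta><\<alpha>. \<exists>E Y. \<exists>w\<in>asg. finite E \<and> (E - D) \<inter> {} = {} \<and> Pdef \<beta> E Y \<and>
        (\<forall>x\<in>D. v x = w x) \<and> Y w \<and> (\<forall>u\<in>asg. Y u \<longrightarrow> (\<exists>X\<in>\<X>. X u))"
      using X(1) by (intro exI[of _ \<beta>] conjI exI[of _ E] exI[of _ Y] bexI[of _ w]) auto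
  qed
  then show ?thesis by (rule Sdef_if_locally) (use assms in auto)
qed

lemma Pdef_Inter:
  assumes "\<And>X. X \<in> \<X> \<Longrightarrow> Pdef \<alpha> D X" "\<not> ord_zero \<alpha>" "finite D"
  shows "Pdef \<alpha> D (\<lambda>v. \<forall>X\<in>\<X>. X v)"
proof -
  have "Sdef \<alpha> D (\<lambda>v. \<exists>X\<in>(\<lambda>X v. \<not> X v) ` \<X>. X v)"
    using assms by (intro Sdef_Union) (auto simp: Pdef_def)
  then show ?thesis unfolding Pdef_def by (rule Sdef_cong) auto
qed

text \<open>Variables of \<open>D - D'\<close> join the witnesses: a neighbourhood for
  \<open>X\<close> serves for the projection with the same \<open>E\<close> and
  \<open>Y\<close>.\<close>

lemma Sdef_project:
  assumes "Sdef \<alpha> D X" "\<not> ord_zero \<alpha>" "finite D" "D' \<subseteq> D"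
  shows "Sdef \<alpha> D' (\<lambda>v. \<exists>w\<in>asg. (\<forall>x\<in>D'. v x = w x) \<and> X w)" (is "Sdef _ _ ?Q")
proof -
  have loc: "locally \<alpha> {} D X"
    using assms by (intro locally_if_Sdef) auto
  have "locally \<alpha> {} D' ?Q"
  proof (rule locallyI)
    fix v w assume "v \<in> asg" "w \<in> asg" "\<And>x. x \<in> D' \<Longrightarrow> v x = w x" "?Q v"
    then show "?Q w" by auto
  next
    fix v assume v: "v \<in> asg" "?Q v"
    then obtain w where w: "w \<in> asg" "\<And>x. x \<in> D' \<Longrightarrow> v x = w x" "X w" by auto
    from locallyE[OF loc w(1,3)] obtain \<beta> E Y w'
      where "\<beta> < \<alpha>" "finite E" "Pdef \<beta> E Y" "w' \<in> asg"
        "\<And>x. x \<in> D \<Longrightarrow> w x = w' x" "Y w'" "\<And>u. u \<in> asg \<Longrightarrow> Y u \<Longrightarrow> X u" by metis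
    then show "\<exists>\<beta><\<alpha>. \<exists>E Y. \<exists>w\<in>asg. finite E \<and> (E - D') \<inter> {} = {} \<and> Pdef \<beta> E Y \<and>
        (\<forall>x\<in>D'. v x = w x) \<and> Y w \<and> (\<forall>u\<in>asg. Y u \<longrightarrow> ?Q u)"
      using w(2) assms(4)
      by (intro exI[of _ \<beta>] conjI exI[of _ E] exI[of _ Y] bexI[of _ w']) auto
  qed
  then show ?thesis
    by (rule Sdef_if_locally) (use assms finite_subset in auto)
qed

lemma Sdef_Ex:
  assumes "Sdef \<alpha> (insert x D) X" "\<not> ord_zero \<alpha>" "finite D"
  shows "Sdef \<alpha> D (\<lambda>v. \<exists>a\<in>carrier M. X (v(x := a)))"
proof -
  \<comment> \<open>The variable \<open>x\<close> is bound even if it lies in \<open>D\<close>, so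
    its outer value has to be forgotten as well.\<close>
  have "Sdef \<alpha> (D - {x}) (\<lambda>v. \<exists>w\<in>asg. (\<forall>y\<in>D - {x}. v y = w y) \<and> X w)"
    using assms by (intro Sdef_project[where D = "insert x D"]) auto
  then have "Sdef \<alpha> D (\<lambda>v. \<exists>w\<in>asg. (\<forall>y\<in>D - {x}. v y = w y) \<and> X w)"
    by (rule Sdef_mono) auto
  then show ?thesis
  proof (rule Sdef_cong)
    fix v assume v: "v \<in> asg"
    show "(\<exists>w\<in>asg. (\<forall>y\<in>D - {x}. v y = w y) \<and> X w) \<longleftrightarrow> (\<exists>a\<in>carrier M. X (v(x := a)))"
    proof
      assume "\<exists>w\<in>asg. (\<forall>y\<in>D - {x}. v y = w y) \<and> X w"
      then obtain w where w: "w \<in> asg" "\<forall>y\<in>D - {x}. v y = w y" "X w" by auto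
      have "X w \<longleftrightarrow> X (v(x := w x))"
        by (rule Sdef_depends[OF assms(1)]) (use w v in \<open>auto intro: asgI\<close>)
      then show "\<exists>a\<in>carrier M. X (v(x := a))" using w by auto
    next
      assume "\<exists>a\<in>carrier M. X (v(x := a))"
      then obtain a where "a \<in> carrier M" "X (v(x := a))" by auto
      then show "\<exists>w\<in>asg. (\<forall>y\<in>D - {x}. v y = w y) \<and> X w"
        using v by (intro bexI[of _ "v(x := a)"]) (auto intro: asgI)
    qed
  qed
qed

lemma Pdef_All:
  assumes "Pdef \<alpha> (insert x D) X" "\<not> ord_zero \<alpha>" "finite D"
  shows "Pdef \<alpha> D (\<lambda>v. \<forall>a\<in>carrier M. X (v(x := a)))"
  using Sdef_Ex[of \<alpha> x D "\<lambda>v. \<not> X v"] assms unfolding Pdef_def by simp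

lemma not_ord_zero_if_less: "\<beta> < \<alpha> \<Longrightarrow> \<not> ord_zero \<alpha>"
  by (auto simp: ord_zero_def)

text \<open>The case of neighbourhoods without witnesses (\<open>E = D\<close>). It turns a union of
  \<open>Pdef\<close> sets of level \<open>\<beta>\<close>, such as the barred classes provide, into
  a single definition at any higher level.\<close>

lemma Sdef_if_Pdef_below:
  assumes "finite D" "\<And>v w. v \<in> asg \<Longrightarrow> w \<in> asg \<Longrightarrow> (\<And>x. x \<in> D \<Longrightarrow> v x = w x) \<Longrightarrow> X v \<Longrightarrow> X w"
    and "\<And>v. v \<in> asg \<Longrightarrow> X v \<Longrightarrow> \<exists>Y. Pdef \<beta> D Y \<and> Y v \<and> (\<forall>u\<in>asg. Y u \<longrightarrow> X u)"
    and "\<beta> < \<alpha>"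
  shows "Sdef \<alpha> D X"
proof -
  have "locally \<alpha> {} D X"
  proof (rule locallyI)
    fix v assume v: "v \<in> asg" "X v"
    from assms(3)[OF this] obtain Y where "Pdef \<beta> D Y" "Y v" "\<forall>u\<in>asg. Y u \<longrightarrow> X u" by auto
    then show "\<exists>\<beta><\<alpha>. \<exists>E Y. \<exists>w\<in>asg. finite E \<and> (E - D) \<inter> {} = {} \<and> Pdef \<beta> E Y \<and>
        (\<forall>x\<in>D. v x = w x) \<and> Y w \<and> (\<forall>u\<in>asg. Y u \<longrightarrow> X u)"
      using assms(1,4) v
      by (intro exI[of _ \<beta>] conjI exI[of _ D] exI[of _ Y] bexI[of _ v]) auto
  qed (use assms(2) in blast)
  then show ?thesis by (rule Sdef_if_locally) (use assms(1) not_ord_zero_if_less[OF assms(4)] in auto)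
qed

lemma Sdef_of_Pdef_less:
  assumes "Pdef \<beta> D X" "\<beta> < \<alpha>" "finite D"
  shows "Sdef \<alpha> D X"
proof (rule Sdef_if_Pdef_below[OF assms(3) _ _ assms(2)])
  show "X w" if "v \<in> asg" "w \<in> asg" "\<And>x. x \<in> D \<Longrightarrow> v x = w x" "X v" for v w
    using Pdef_depends[OF assms(1) that(1-3)] that(4) by simp
  show "\<exists>Y. Pdef \<beta> D Y \<and> Y v \<and> (\<forall>u\<in>asg. Y u \<longrightarrow> X u)" if "X v" for v
    using assms that by (intro exI[of _ X]) auto
qed

lemma Pdef_of_Sdef_less:
  assumes "Sdef \<beta> D X" "\<beta> < \<alpha>" "finite D"
  shows "Pdef \<alpha> D X"
  unfolding Pdef_def
  by (rule Sdef_of_Pdef_less[OF _ assms(2,3)]) (use assms in \<open>simp add: Pdef_def\<close>)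

lemma Sdef_zero_iff_Pdef: "ord_zero \<alpha> \<Longrightarrow> Sdef \<alpha> D X \<longleftrightarrow> Pdef \<alpha> D X"
proof -
  assume z: "ord_zero \<alpha>"
  have *: "Pdef \<alpha> D X" if S: "Sdef \<alpha> D X" for X
  proof -
    obtain \<phi> where "qf_fm L \<phi>" "fv \<phi> \<subseteq> D" "\<forall>v\<in>asg. sat M \<phi> v \<longleftrightarrow> X v"
      using S by (auto simp: Sdef_def Sigma_fm_zero_iff[OF z])
    then show ?thesis
      unfolding Pdef_def Sdef_def Sigma_fm_zero_iff[OF z]
      by (intro exI[of _ "neg \<phi>"]) (auto intro: qf_fm_neg)
  qed
  show ?thesis
    using *[of X] *[of "\<lambda>v. \<not> X v"] by (auto simp: Pdef_def)
qed

text \<open>For positive \<open>\<beta>\<close> the same neighbourhoods serve at both levels. Level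
  zero has no neighbourhoods and passes through \<open>Pdef\<close>, since quantifier-free formulas
  are closed under negation.\<close>

lemma Sdef_le:
  assumes "Sdef \<beta> D X" "\<beta> \<le> \<alpha>" "finite D"
  shows "Sdef \<alpha> D X"
proof (cases "\<beta> = \<alpha>")
  case False
  then have less: "\<beta> < \<alpha>" using assms by auto
  show ?thesis
  proof (cases "ord_zero \<beta>")
    case True
    then show ?thesis using Sdef_of_Pdef_less[OF _ less assms(3)] assms(1) by (simp add: Sdef_zero_iff_Pdef)
  next
    case False
    have loc: "locally \<beta> {} D X"
      using assms False by (intro locally_if_Sdef) auto
    have "locally \<alpha> {} D X"
    proof (rule locallyI)
      fix v assume v: "v \<in> asg" "X v"
      from locallyE[OF loc v] obtain \<gamma> E Y w
        where "\<gamma> < \<beta>" "finite E" "Pdef \<gamma> E Y" "w \<in> asg"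
          "\<And>x. x \<in> D \<Longrightarrow> v x = w x" "Y w" "\<And>u. u \<in> asg \<Longrightarrow> Y u \<Longrightarrow> X u" by metis
      then show "\<exists>\<beta><\<alpha>. \<exists>E Y. \<exists>w\<in>asg. finite E \<and> (E - D) \<inter> {} = {} \<and> Pdef \<beta> E Y \<and>
          (\<forall>x\<in>D. v x = w x) \<and> Y w \<and> (\<forall>u\<in>asg. Y u \<longrightarrow> X u)"
        using less by (intro exI[of _ \<gamma>] conjI exI[of _ E] exI[of _ Y] bexI[of _ w]) auto
    qed (rule locally_depends[OF loc])
    then show ?thesis by (rule Sdef_if_locally) (use assms not_ord_zero_if_less[OF less] in auto)
  qed
qed (use assms in simp)

lemma Pdef_le:
  assumes "Pdef \<beta> D X" "\<beta> \<le> \<alpha>" "finite D"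
  shows "Pdef \<alpha> D X"
  using assms unfolding Pdef_def by (rule Sdef_le)

lemma Pdef_conj:
  assumes "Pdef \<alpha> D X" "Pdef \<alpha> D Y" "finite D"
  shows "Pdef \<alpha> D (\<lambda>v. X v \<and> Y v)"
proof (cases "ord_zero \<alpha>")
  case True
  have S: "Sdef \<alpha> D X" "Sdef \<alpha> D Y" using assms True by (auto simp: Sdef_zero_iff_Pdef)
  obtain \<phi> where \<phi>: "qf_fm L \<phi>" "fv \<phi> \<subseteq> D" "\<forall>v\<in>asg. sat M \<phi> v \<longleftrightarrow> X v"
    using S(1) by (auto simp: Sdef_def Sigma_fm_zero_iff[OF True])
  obtain \<psi> where \<psi>: "qf_fm L \<psi>" "fv \<psi> \<subseteq> D" "\<forall>v\<in>asg. sat M \<psi> v \<longleftrightarrow> Y v"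
    using S(2) by (auto simp: Sdef_def Sigma_fm_zero_iff[OF True])
  have "Sdef \<alpha> D (\<lambda>v. X v \<and> Y v)"
    unfolding Sdef_def Sigma_fm_zero_iff[OF True] using \<phi> \<psi>
    by (intro exI[of _ "Conj (acset {\<phi>, \<psi>})"]) (auto intro!: qf_fm.intros)
  then show ?thesis using True by (simp add: Sdef_zero_iff_Pdef)
next
  case False
  have "Pdef \<alpha> D (\<lambda>v. \<forall>Z\<in>{X, Y}. Z v)"
    using assms False by (intro Pdef_Inter) auto
  then show ?thesis by simp
qed

text \<open>Two neighbourhoods can be intersected once the witnesses of each are off the variables
  of the other. Together with \<open>Sdef_Union\<close> this gives the topology.\<close>

lemma Sdef_conj:
  assumes "Sdef \<alpha> D X" "Sdef \<alpha> D' X'" "\<not> ord_zero \<alpha>" "finite D" "finite D'"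
  shows "Sdef \<alpha> (D \<union> D') (\<lambda>v. X v \<and> X' v)"
proof -
  have "locally \<alpha> {} (D \<union> D') (\<lambda>v. X v \<and> X' v)"
  proof (rule locallyI)
    fix v w assume "v \<in> asg" "w \<in> asg" "\<And>x. x \<in> D \<union> D' \<Longrightarrow> v x = w x" "X v \<and> X' v"
    then show "X w \<and> X' w"
      using Sdef_depends[OF assms(1), of v w] Sdef_depends[OF assms(2), of v w] by auto
  next
    fix v assume v: "v \<in> asg" "X v \<and> X' v"
    have "locally \<alpha> D' D X"
      using assms by (intro locally_if_Sdef) auto
    from locallyE[OF this v(1)] v(2) obtain \<beta> E Y w
      where 1: "\<beta> < \<alpha>" "finite E" "(E - D) \<inter> D' = {}" "Pdef \<beta> E Y" "w \<in> asg"
        "\<And>x. x \<in> D \<Longrightarrow> v x = w x" "Y w" "\<And>u. u \<in> asg \<Longrightarrow> Y u \<Longrightarrow> X u" by metis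
    \<comment> \<open>The second neighbourhood has to avoid all of \<open>E\<close> and not just
      \<open>D\<close>, since \<open>E\<close> carries the witnesses just found.\<close>
    have "locally \<alpha> (E \<union> D) D' X'"
      using assms 1(2) by (intro locally_if_Sdef) auto
    from locallyE[OF this v(1)] v(2) obtain \<beta>' E' Y' w'
      where 2: "\<beta>' < \<alpha>" "finite E'" "(E' - D') \<inter> (E \<union> D) = {}" "Pdef \<beta>' E' Y'" "w' \<in> asg"
        "\<And>x. x \<in> D' \<Longrightarrow> v x = w' x" "Y' w'" "\<And>u. u \<in> asg \<Longrightarrow> Y' u \<Longrightarrow> X' u" by metis
    \<comment> \<open>The glued point: the two disjointness conditions make it agree with
      \<open>w\<close> on \<open>E\<close> and with \<open>w'\<close> on \<open>E'\<close>.\<close>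
    define t where "t x = (if x \<in> E - D then w x else if x \<in> E' - D' then w' x else v x)" for x
    have t: "t \<in> asg" using v 1(5) 2(5) by (auto intro!: asgI simp: t_def)
    have "t x = w x" if "x \<in> E" for x
      using that 1(3,6) 2(3) by (auto simp: t_def)
    then have "Y t" using Pdef_depends[OF 1(4) t 1(5)] 1(7) by auto
    moreover have "t x = w' x" if "x \<in> E'" for x
      using that 1(3) 2(3,6) by (auto simp: t_def)
    then have "Y' t" using Pdef_depends[OF 2(4) t 2(5)] 2(7) by auto
    moreover have "\<forall>x\<in>D \<union> D'. v x = t x"
      using 1(3) 2(3) by (auto simp: t_def)
    moreover have "Pdef (max \<beta> \<beta>') (E \<union> E') (\<lambda>u. Y u \<and> Y' u)"
    proof (rule Pdef_conj)
      show "Pdef (max \<beta> \<beta>') (E \<union> E') Y"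
        by (rule Pdef_le[OF Pdef_mono[OF 1(4)]]) (use 1 2 in auto)
      show "Pdef (max \<beta> \<beta>') (E \<union> E') Y'"
        by (rule Pdef_le[OF Pdef_mono[OF 2(4)]]) (use 1 2 in auto)
    qed (use 1 2 in auto)
    ultimately show "\<exists>\<beta><\<alpha>. \<exists>E Y. \<exists>w\<in>asg. finite E \<and> (E - (D \<union> D')) \<inter> {} = {} \<and> Pdef \<beta> E Y \<and>
        (\<forall>x\<in>D \<union> D'. v x = w x) \<and> Y w \<and> (\<forall>u\<in>asg. Y u \<longrightarrow> X u \<and> X' u)"
      using 1(1,2,8) 2(1,2,8) t
      by (intro exI[of _ "max \<beta> \<beta>'"] conjI exI[of _ "E \<union> E'"] exI[of _ "\<lambda>u. Y u \<and> Y' u"]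
          bexI[of _ t]) auto
  qed
  then show ?thesis by (rule Sdef_if_locally) (use assms in auto)
qed

section \<open>The formula classes evaluated in \<open>M\<close>\<close>

lemma Sdef_Sigma_fm: "Sigma_fm L \<alpha> \<phi> \<Longrightarrow> fv \<phi> \<subseteq> D \<Longrightarrow> Sdef \<alpha> D (sat M \<phi>)"
  unfolding Sdef_def by blast

lemma Pdef_Pi_fm: "Pi_fm L \<alpha> \<phi> \<Longrightarrow> fv \<phi> \<subseteq> D \<Longrightarrow> Pdef \<alpha> D (sat M \<phi>)"
  unfolding Pdef_iff by blast

lemma Sdef_qf_fm:
  assumes "qf_fm L \<phi>" "fv \<phi> \<subseteq> D" "finite D" "\<not> ord_zero \<alpha>"
  shows "Sdef \<alpha> D (sat M \<phi>)"
proof -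
  \<comment> \<open>In an arbitrary well-order zero has to be found: the least ordinal below
    \<open>\<alpha>\<close> has no predecessors.\<close>
  define z where "z = (LEAST \<beta>. \<beta> < \<alpha>)"
  obtain \<beta> where "\<beta> < \<alpha>" using assms(4) by (auto simp: ord_zero_def)
  then have z: "z < \<alpha>" unfolding z_def by (rule LeastI)
  have "ord_zero z"
    unfolding ord_zero_def using z not_less_Least[where P = "\<lambda>\<beta>. \<beta> < \<alpha>"]
    by (auto simp: z_def dest: order.strict_trans)
  then have "Sdef z D (sat M \<phi>)"
    using assms by (intro Sdef_Sigma_fm Sigma_fm_Pi_fm.intros) auto
  then show ?thesis by (rule Sdef_le) (use z assms in auto)
qed

text \<open>The barred classes get only a pointwise statement: around each satisfying point an
  \<open>Abar_fm\<close> formula contains a \<open>Pdef\<close> set, and dually an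
  \<open>Ebar_fm\<close> formula lies inside an \<open>Sdef\<close> set missing a given point of
  failure. This form passes through both infinite connectives, and the rules that raise the level
  turn it into a definition by \<open>Sdef_if_Pdef_below\<close>.\<close>

lemma
  shows Pdef_A_fm: "A_fm L \<alpha> \<phi> \<Longrightarrow> finite D \<Longrightarrow> fv \<phi> \<subseteq> D \<Longrightarrow> Pdef \<alpha> D (sat M \<phi>)"
    and Sdef_E_fm: "E_fm L \<alpha> \<phi> \<Longrightarrow> finite D \<Longrightarrow> fv \<phi> \<subseteq> D \<Longrightarrow> Sdef \<alpha> D (sat M \<phi>)"
    and Abar_fm_local: "Abar_fm L \<alpha> \<phi> \<Longrightarrow> finite D \<Longrightarrow> fv \<phi> \<subseteq> D \<Longrightarrow>
      (\<forall>v\<in>asg. sat M \<phi> v \<longrightarrow> (\<exists>Y. Pdef \<alpha> D Y \<and> Y v \<and> (\<forall>u\<in>asg. Y u \<longrightarrow> sat M \<phi> u)))"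
    and Ebar_fm_local: "Ebar_fm L \<alpha> \<phi> \<Longrightarrow> finite D \<Longrightarrow> fv \<phi> \<subseteq> D \<Longrightarrow>
      (\<forall>v\<in>asg. \<not> sat M \<phi> v \<longrightarrow> (\<exists>Y. Sdef \<alpha> D Y \<and> \<not> Y v \<and> (\<forall>u\<in>asg. sat M \<phi> u \<longrightarrow> Y u)))"
proof (induction arbitrary: D and D and D and D rule: A_fm_E_fm_Abar_fm_Ebar_fm.inducts)
  case (A_one \<alpha> \<phi>)
  then show ?case by (intro Pdef_Pi_fm)
next
  case (A_lower \<beta> \<alpha> \<phi>)
  show ?case unfolding Pdef_def
  proof (rule Sdef_if_Pdef_below[OF A_lower.prems(1) _ _ A_lower.hyps(2)])
    fix v w assume "\<And>x. x \<in> D \<Longrightarrow> v x = w x" "\<not> sat M \<phi> v"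
    then show "\<not> sat M \<phi> w" using sat_cong[of \<phi> v w M] A_lower.prems by auto
  next
    fix v assume "v \<in> asg" "\<not> sat M \<phi> v"
    then obtain Y where "Sdef \<beta> D Y \<and> \<not> Y v \<and> (\<forall>u\<in>asg. sat M \<phi> u \<longrightarrow> Y u)"
      using A_lower.IH(2)[OF A_lower.prems] by blast
    then show "\<exists>Y. Pdef \<beta> D Y \<and> Y v \<and> (\<forall>u\<in>asg. Y u \<longrightarrow> \<not> sat M \<phi> u)"
      by (intro exI[of _ "\<lambda>u. \<not> Y u"]) (auto simp: Pdef_def)
  qed
next
  case (A_All \<alpha> \<phi> x)
  then have "Pdef \<alpha> (insert x D) (sat M \<phi>)" by auto
  then show ?case using Pdef_All[of \<alpha> x D "sat M \<phi>"] A_All by (auto simp: ord_gt_one_def)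
next
  case (A_Conj \<alpha> \<Phi>)
  have "Pdef \<alpha> D (\<lambda>v. \<forall>X\<in>sat M ` rcset \<Phi>. X v)"
    using A_Conj by (intro Pdef_Inter) (auto simp: ord_gt_one_def)
  then show ?case by (rule Pdef_cong) auto
next
  case (E_one \<alpha> \<phi>)
  then show ?case by (intro Sdef_Sigma_fm)
next
  case (E_lower \<beta> \<alpha> \<phi>)
  show ?case
  proof (rule Sdef_if_Pdef_below[OF E_lower.prems(1) _ _ E_lower.hyps(2)])
    fix v w assume "\<And>x. x \<in> D \<Longrightarrow> v x = w x" "sat M \<phi> v"
    then show "sat M \<phi> w" using sat_cong[of \<phi> v w M] E_lower.prems by auto
  next
    fix v assume "v \<in> asg" "sat M \<phi> v"
    then show "\<exists>Y. Pdef \<beta> D Y \<and> Y v \<and> (\<forall>u\<in>asg. Y u \<longrightarrow> sat M \<phi> u)"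
      using E_lower.IH(2)[OF E_lower.prems] by blast
  qed
next
  case (E_Ex \<alpha> \<phi> x)
  then have "Sdef \<alpha> (insert x D) (sat M \<phi>)" by auto
  then show ?case using Sdef_Ex[of \<alpha> x D "sat M \<phi>"] E_Ex by (auto simp: ord_gt_one_def)
next
  case (E_Disj \<alpha> \<Phi>)
  have "Sdef \<alpha> D (\<lambda>v. \<exists>X\<in>sat M ` rcset \<Phi>. X v)"
    using E_Disj by (intro Sdef_Union) (auto simp: ord_gt_one_def)
  then show ?case by (rule Sdef_cong) auto
next
  case (Abar_base \<alpha> \<phi>)
  then show ?case by blast
next
  case (Abar_Conj \<alpha> \<Phi>)
  show ?case
  proof (intro ballI impI)
    fix v assume v: "v \<in> asg" "sat M (Conj \<Phi>) v"
    have "\<exists>Y. Pdef \<alpha> D Y \<and> Y v \<and> (\<forall>u\<in>asg. Y u \<longrightarrow> sat M \<phi> u)" if "\<phi> \<in> rcset \<Phi>" for \<phi>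
      using Abar_Conj that v by (auto simp: SUP_le_iff)
    \<comment> \<open>One approximation per conjunct, all at the same point \<open>v\<close>; the
      disjunct used inside a conjunct may change from point to point.\<close>
    then obtain Y where Y: "\<And>\<phi>. \<phi> \<in> rcset \<Phi> \<Longrightarrow>
        Pdef \<alpha> D (Y \<phi>) \<and> Y \<phi> v \<and> (\<forall>u\<in>asg. Y \<phi> u \<longrightarrow> sat M \<phi> u)" by metis
    have "Pdef \<alpha> D (\<lambda>v. \<forall>X\<in>Y ` rcset \<Phi>. X v)"
      using Abar_Conj Y by (intro Pdef_Inter) auto
    then show "\<exists>Y. Pdef \<alpha> D Y \<and> Y v \<and> (\<forall>u\<in>asg. Y u \<longrightarrow> sat M (Conj \<Phi>) u)"
      using Y by (intro exI[of _ "\<lambda>v. \<forall>X\<in>Y ` rcset \<Phi>. X v"]) auto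
  qed
next
  case (Abar_Disj \<alpha> \<Phi>)
  show ?case
  proof (intro ballI impI)
    fix v assume v: "v \<in> asg" "sat M (Disj \<Phi>) v"
    then obtain \<phi> where \<phi>: "\<phi> \<in> rcset \<Phi>" "sat M \<phi> v" by auto
    then have "\<exists>Y. Pdef \<alpha> D Y \<and> Y v \<and> (\<forall>u\<in>asg. Y u \<longrightarrow> sat M \<phi> u)"
      using Abar_Disj v by (auto simp: SUP_le_iff)
    then show "\<exists>Y. Pdef \<alpha> D Y \<and> Y v \<and> (\<forall>u\<in>asg. Y u \<longrightarrow> sat M (Disj \<Phi>) u)"
      using \<phi>(1) by auto
  qed
next
  case (Ebar_base \<alpha> \<phi>)
  then show ?case by blast
next
  case (Ebar_Conj \<alpha> \<Phi>)
  show ?case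
  proof (intro ballI impI)
    fix v assume v: "v \<in> asg" "\<not> sat M (Conj \<Phi>) v"
    then obtain \<phi> where \<phi>: "\<phi> \<in> rcset \<Phi>" "\<not> sat M \<phi> v" by auto
    then have "\<exists>Y. Sdef \<alpha> D Y \<and> \<not> Y v \<and> (\<forall>u\<in>asg. sat M \<phi> u \<longrightarrow> Y u)"
      using Ebar_Conj v by (auto simp: SUP_le_iff)
    then show "\<exists>Y. Sdef \<alpha> D Y \<and> \<not> Y v \<and> (\<forall>u\<in>asg. sat M (Conj \<Phi>) u \<longrightarrow> Y u)"
      using \<phi>(1) by auto
  qed
next
  case (Ebar_Disj \<alpha> \<Phi>)
  show ?case
  proof (intro ballI impI)
    fix v assume v: "v \<in> asg" "\<not> sat M (Disj \<Phi>) v"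
    have "\<exists>Y. Sdef \<alpha> D Y \<and> \<not> Y v \<and> (\<forall>u\<in>asg. sat M \<phi> u \<longrightarrow> Y u)" if "\<phi> \<in> rcset \<Phi>" for \<phi>
      using Ebar_Disj that v by (auto simp: SUP_le_iff)
    then obtain Y where Y: "\<And>\<phi>. \<phi> \<in> rcset \<Phi> \<Longrightarrow>
        Sdef \<alpha> D (Y \<phi>) \<and> \<not> Y \<phi> v \<and> (\<forall>u\<in>asg. sat M \<phi> u \<longrightarrow> Y \<phi> u)" by metis
    have "Sdef \<alpha> D (\<lambda>v. \<exists>X\<in>Y ` rcset \<Phi>. X v)"
      using Ebar_Disj Y by (intro Sdef_Union) auto
    then show "\<exists>Y. Sdef \<alpha> D Y \<and> \<not> Y v \<and> (\<forall>u\<in>asg. sat M (Disj \<Phi>) u \<longrightarrow> Y u)"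
      using Y by (intro exI[of _ "\<lambda>v. \<exists>X\<in>Y ` rcset \<Phi>. X v"]) auto
  qed
qed

text \<open>Openness is hereditary because the truth lemma descends to subformulas, each of which
  becomes a requirement. The clause on \<open>Neg\<close> confines negation to quantifier-free
  formulas, where truth is two-sided.\<close>

definition good :: "'o::wellorder \<Rightarrow> 'r fm \<Rightarrow> bool" where
  "good \<alpha> \<phi> \<longleftrightarrow> (\<forall>\<psi>\<in>subfms \<phi>. finite (fv \<psi>) \<and> Sdef \<alpha> (fv \<psi>) (sat M \<psi>) \<and>
     (\<forall>\<chi>. \<psi> = Neg \<chi> \<longrightarrow> qf_fm L \<chi>))"

lemma good_Sdef: "good \<alpha> \<phi> \<Longrightarrow> Sdef \<alpha> (fv \<phi>) (sat M \<phi>)"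
  and good_finite: "good \<alpha> \<phi> \<Longrightarrow> finite (fv \<phi>)"
  by (auto simp: good_def subfms_refl)

lemma good_qf: "qf_fm L \<phi> \<Longrightarrow> \<not> ord_zero \<alpha> \<Longrightarrow> good \<alpha> \<phi>"
proof (induction rule: qf_fm.induct)
  case (qf_Eq x y)
  have "Sdef \<alpha> {x, y} (sat M (Eq x y))"
    using qf_Eq by (intro Sdef_qf_fm qf_fm.intros) auto
  then show ?case by (simp add: good_def)
next
  case (qf_Rel r xs)
  then have "Sdef \<alpha> (set xs) (sat M (Rel r xs))"
    by (intro Sdef_qf_fm qf_fm.intros) auto
  then show ?case by (simp add: good_def)
next
  case (qf_Neg \<phi>)
  then have "Sdef \<alpha> (fv \<phi>) (sat M (Neg \<phi>))"
    by (intro Sdef_qf_fm qf_fm.intros) (auto intro: good_finite)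
  then show ?case using qf_Neg good_finite[of \<alpha> \<phi>] by (auto simp: good_def)
next
  case (qf_Conj \<Phi>)
  then have fin: "finite (fv (Conj \<Phi>))" by (auto intro: good_finite)
  then have "Sdef \<alpha> (fv (Conj \<Phi>)) (sat M (Conj \<Phi>))"
    using qf_Conj by (intro Sdef_qf_fm qf_fm.intros) auto
  then show ?case using qf_Conj fin by (auto simp: good_def rcset_cimage simp del: fv_Conj)
next
  case (qf_Disj \<Phi>)
  then have fin: "finite (fv (Disj \<Phi>))" by (auto intro: good_finite)
  then have "Sdef \<alpha> (fv (Disj \<Phi>)) (sat M (Disj \<Phi>))"
    using qf_Disj by (intro Sdef_qf_fm qf_fm.intros) auto
  then show ?case using qf_Disj fin by (auto simp: good_def rcset_cimage simp del: fv_Disj)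
qed

text \<open>Open sets are not closed under infinite intersection, so openness of the conjunction is
  a premise, to be supplied by a bound on its level. The same goes for \<open>good_All\<close>,
  while disjunctions and existential formulas inherit openness.\<close>

lemma good_Conj:
  "Sdef \<alpha> (fv (Conj \<Phi>)) (sat M (Conj \<Phi>)) \<Longrightarrow> finite (fv (Conj \<Phi>)) \<Longrightarrow>
    (\<And>\<phi>. \<phi> \<in> rcset \<Phi> \<Longrightarrow> good \<alpha> \<phi>) \<Longrightarrow> good \<alpha> (Conj \<Phi>)"
  by (auto simp: good_def rcset_cimage simp del: fv_Conj)

lemma good_All:
  "Sdef \<alpha> (fv (All x \<phi>)) (sat M (All x \<phi>)) \<Longrightarrow> good \<alpha> \<phi> \<Longrightarrow> good \<alpha> (All x \<phi>)"
  using good_finite[of \<alpha> \<phi>] by (auto simp: good_def simp del: sat.simps)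

lemma good_Disj:
  assumes "finite (fv (Disj \<Phi>))" "\<And>\<phi>. \<phi> \<in> rcset \<Phi> \<Longrightarrow> good \<alpha> \<phi>" "\<not> ord_zero \<alpha>"
  shows "good \<alpha> (Disj \<Phi>)"
proof -
  have "Sdef \<alpha> (fv (Disj \<Phi>)) (\<lambda>v. \<exists>X\<in>sat M ` rcset \<Phi>. X v)"
  proof (rule Sdef_Union)
    fix X assume "X \<in> sat M ` rcset \<Phi>"
    then obtain \<phi> where \<phi>: "\<phi> \<in> rcset \<Phi>" "X = sat M \<phi>" by auto
    then have "Sdef \<alpha> (fv \<phi>) X" using good_Sdef assms(2) by auto
    then show "Sdef \<alpha> (fv (Disj \<Phi>)) X" by (rule Sdef_mono) (use \<phi>(1) in auto)
  qed (use assms in auto)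
  then have "Sdef \<alpha> (fv (Disj \<Phi>)) (sat M (Disj \<Phi>))" by (rule Sdef_cong) auto
  then show ?thesis using assms by (auto simp: good_def rcset_cimage simp del: fv_Disj)
qed

lemma good_Ex:
  assumes "good \<alpha> \<phi>" "\<not> ord_zero \<alpha>"
  shows "good \<alpha> (Ex x \<phi>)"
proof -
  have fin: "finite (fv (Ex x \<phi>))" using good_finite[OF assms(1)] by simp
  have "Sdef \<alpha> (insert x (fv (Ex x \<phi>))) (sat M \<phi>)"
    using good_Sdef[OF assms(1)] by (rule Sdef_mono) auto
  from Sdef_Ex[OF this assms(2) fin] have "Sdef \<alpha> (fv (Ex x \<phi>)) (sat M (Ex x \<phi>))" by simp
  then show ?thesis using assms fin by (auto simp: good_def simp del: fv.simps sat.simps)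
qed

lemma good_exs: "good \<alpha> \<phi> \<Longrightarrow> \<not> ord_zero \<alpha> \<Longrightarrow> good \<alpha> (exs ys \<phi>)"
  by (induction ys) (auto intro: good_Ex)

text \<open>Every suffix of the quantifier block is a subformula. All suffixes stay at
  \<open>Pdef \<gamma>\<close>, however many quantifiers there are, so two strict steps suffice:
  from \<open>\<beta>\<close> to a universal class at \<open>\<gamma>\<close>, and from there to an
  existential one at \<open>\<alpha>\<close>.\<close>

lemma good_alls:
  assumes "good \<alpha> \<phi>" "Sdef \<beta> (fv \<phi>) (sat M \<phi>)" "\<beta> < \<gamma>" "\<gamma> < \<alpha>"
  shows "good \<alpha> (alls ys \<phi>)"
proof -
  have fin: "finite (fv (alls ys \<phi>))" for ys using good_finite[OF assms(1)] by simp
  have P: "Pdef \<gamma> (fv (alls ys \<phi>)) (sat M (alls ys \<phi>))" for ys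
  proof (induction ys)
    case Nil
    then show ?case using Pdef_of_Sdef_less[OF assms(2,3)] good_finite[OF assms(1)] by simp
  next
    case (Cons y ys)
    have "Pdef \<gamma> (insert y (fv (alls (y # ys) \<phi>))) (sat M (alls ys \<phi>))"
      using Cons.IH by (rule Pdef_mono) auto
    from Pdef_All[OF this not_ord_zero_if_less[OF assms(3)] fin] show ?case by simp
  qed
  show ?thesis
  proof (induction ys)
    case (Cons y ys)
    have "Sdef \<alpha> (fv (alls (y # ys) \<phi>)) (sat M (alls (y # ys) \<phi>))"
      using P assms(4) fin by (rule Sdef_of_Pdef_less)
    then show ?case using Cons.IH by (simp add: good_All del: fv.simps sat.simps fv_alls)
  qed (use assms in simp)
qed

text \<open>The bounds differ, \<open>\<le>\<close> against \<open><\<close>, because a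
  \<open>Pi_fm\<close> formula of level \<open>\<alpha>\<close> itself need not be open. Inside a
  \<open>Pi_fm\<close> formula of level \<open>\<beta>\<close> the matrices have level
  \<open>\<gamma> < \<beta> < \<alpha>\<close>, exactly the gap that \<open>good_alls\<close> asks
  for.\<close>

lemma
  assumes "\<not> ord_zero (\<alpha> :: 'o::wellorder)"
  shows good_Sigma_fm: "Sigma_fm L (\<beta> :: 'o) \<phi> \<Longrightarrow> \<beta> \<le> \<alpha> \<Longrightarrow> finite (fv \<phi>) \<Longrightarrow> good \<alpha> \<phi>"
    and good_Pi_fm: "Pi_fm L \<beta> \<phi> \<Longrightarrow> \<beta> < \<alpha> \<Longrightarrow> finite (fv \<phi>) \<Longrightarrow> good \<alpha> \<phi>"
proof (induction rule: Sigma_fm_Pi_fm.inducts)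
  case (Sigma_zero \<beta> \<phi>)
  then show ?case using assms by (intro good_qf)
next
  case (Pi_zero \<beta> \<phi>)
  then show ?case using assms by (intro good_qf)
next
  case (Sigma_pos \<beta> \<Phi>)
  show ?case
  proof (rule good_Disj[OF Sigma_pos.prems(2) _ assms])
    fix \<phi> assume \<phi>: "\<phi> \<in> rcset \<Phi>"
    then obtain ys \<psi> \<gamma> where *: "\<phi> = exs ys \<psi>" "\<gamma> < \<beta>"
      "\<gamma> < \<alpha> \<Longrightarrow> finite (fv \<psi>) \<Longrightarrow> good \<alpha> \<psi>"
      using Sigma_pos.IH by blast
    have "fv \<phi> \<subseteq> fv (Disj \<Phi>)" using \<phi> by auto
    then have "finite (fv \<phi>)" using Sigma_pos.prems finite_subset by blast
    then have "finite (fv \<psi>)" using *(1) by simp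
    then have "good \<alpha> \<psi>" using *(2,3) Sigma_pos.prems(1) by auto
    then show "good \<alpha> \<phi>" unfolding *(1) using assms by (rule good_exs)
  qed
next
  case (Pi_pos \<beta> \<Phi>)
  have "Pi_fm L \<beta> (Conj \<Phi>)"
    using Pi_pos by (intro Sigma_fm_Pi_fm.Pi_pos) blast+
  then have "Pdef \<beta> (fv (Conj \<Phi>)) (sat M (Conj \<Phi>))" by (rule Pdef_Pi_fm) auto
  then have "Sdef \<alpha> (fv (Conj \<Phi>)) (sat M (Conj \<Phi>))"
    using Pi_pos.prems by (rule Sdef_of_Pdef_less)
  then show ?case
  proof (rule good_Conj[OF _ Pi_pos.prems(2)])
    fix \<phi> assume \<phi>: "\<phi> \<in> rcset \<Phi>"
    then obtain ys \<psi> \<gamma> where *: "\<phi> = alls ys \<psi>" "\<gamma> < \<beta>" "Sigma_fm L \<gamma> \<psi>"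
      "\<gamma> \<le> \<alpha> \<Longrightarrow> finite (fv \<psi>) \<Longrightarrow> good \<alpha> \<psi>"
      using Pi_pos.IH by blast
    have "fv \<phi> \<subseteq> fv (Conj \<Phi>)" using \<phi> by auto
    then have "finite (fv \<phi>)" using Pi_pos.prems finite_subset by blast
    then have "finite (fv \<psi>)" using *(1) by simp
    then have "good \<alpha> \<psi>" using * Pi_pos.prems(1) by auto
    moreover have "Sdef \<gamma> (fv \<psi>) (sat M \<psi>)" using *(3) by (rule Sdef_Sigma_fm) auto
    ultimately show "good \<alpha> \<phi>"
      unfolding *(1) using *(2) Pi_pos.prems(1) by (rule good_alls)
  qed
qed

text \<open>The class $\overline{\mathfrak{E}}_\beta$ is treated below only for $\beta + 1 < \alpha$: its
  formulas define $\Pi_{\beta+1}$ sets, which need not be open when $\beta + 1 = \alpha$.\<close>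

lemma
  assumes "\<not> ord_zero (\<alpha> :: 'o::wellorder)"
  shows good_A_fm: "A_fm L (\<beta> :: 'o) \<phi> \<Longrightarrow> \<beta> < \<alpha> \<Longrightarrow> finite (fv \<phi>) \<Longrightarrow> good \<alpha> \<phi>"
    and good_E_fm: "E_fm L \<beta> \<phi> \<Longrightarrow> \<beta> \<le> \<alpha> \<Longrightarrow> finite (fv \<phi>) \<Longrightarrow> good \<alpha> \<phi>"
    and good_Abar_fm: "Abar_fm L \<beta> \<phi> \<Longrightarrow> \<beta> < \<alpha> \<Longrightarrow> finite (fv \<phi>) \<Longrightarrow> good \<alpha> \<phi>"
    and good_Ebar_fm: "Ebar_fm L \<beta> \<phi> \<Longrightarrow> (\<exists>\<gamma>>\<beta>. \<gamma> < \<alpha>) \<Longrightarrow> finite (fv \<phi>) \<Longrightarrow> good \<alpha> \<phi>"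
proof (induction rule: A_fm_E_fm_Abar_fm_Ebar_fm.inducts)
  case (A_one \<beta> \<phi>)
  then show ?case using good_Pi_fm[OF assms] by blast
next
  \<comment> \<open>The intermediate ordinal in the hypothesis on \<open>Ebar_fm\<close> is the
    level \<open>\<alpha>'\<close> of the present formula.\<close>
  case (A_lower \<beta> \<alpha>' \<phi>)
  then show ?case by blast
next
  case (A_All \<beta> \<phi> x)
  have "A_fm L \<beta> (All x \<phi>)" using A_All by (intro A_fm_E_fm_Abar_fm_Ebar_fm.A_All)
  then have "Pdef \<beta> (fv (All x \<phi>)) (sat M (All x \<phi>))"
    using A_All.prems by (intro Pdef_A_fm) auto
  then have "Sdef \<alpha> (fv (All x \<phi>)) (sat M (All x \<phi>))"
    using A_All.prems by (rule Sdef_of_Pdef_less)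
  then show ?case using A_All by (intro good_All) auto
next
  case (A_Conj \<beta> \<Phi>)
  have "A_fm L \<beta> (Conj \<Phi>)" using A_Conj by (intro A_fm_E_fm_Abar_fm_Ebar_fm.A_Conj) blast+
  then have "Pdef \<beta> (fv (Conj \<Phi>)) (sat M (Conj \<Phi>))"
    using A_Conj.prems by (intro Pdef_A_fm) auto
  then have S: "Sdef \<alpha> (fv (Conj \<Phi>)) (sat M (Conj \<Phi>))"
    using A_Conj.prems by (rule Sdef_of_Pdef_less)
  have fin: "finite (fv \<phi>)" if "\<phi> \<in> rcset \<Phi>" for \<phi>
    using finite_subset[of "fv \<phi>" "fv (Conj \<Phi>)"] A_Conj.prems(2) that by auto
  show ?case
    by (rule good_Conj[OF S A_Conj.prems(2)]) (use fin A_Conj in blast)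
next
  case (E_one \<beta> \<phi>)
  then show ?case using good_Sigma_fm[OF assms] by blast
next
  case (E_lower \<beta> \<alpha>' \<phi>)
  then show ?case by auto
next
  case (E_Ex \<beta> \<phi> x)
  then show ?case using assms by (intro good_Ex) auto
next
  case (E_Disj \<beta> \<Phi>)
  have fin: "finite (fv \<phi>)" if "\<phi> \<in> rcset \<Phi>" for \<phi>
    using finite_subset[of "fv \<phi>" "fv (Disj \<Phi>)"] E_Disj.prems(2) that by auto
  show ?case
    by (rule good_Disj[OF E_Disj.prems(2) _ assms]) (use fin E_Disj in blast)
next
  case (Abar_base \<beta> \<phi>)
  then show ?case by blast
next
  case (Abar_Conj \<beta> \<Phi>)
  have "Abar_fm L \<beta> (Conj \<Phi>)"
    using Abar_Conj by (intro A_fm_E_fm_Abar_fm_Ebar_fm.Abar_Conj) blast+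
  \<comment> \<open>At level \<open>\<alpha>\<close> the conjunction counts as existential, and the
    pointwise resolution behind \<open>Sdef_E_fm\<close> makes it open.\<close>
  then have "E_fm L \<alpha> (Conj \<Phi>)"
    using Abar_Conj by (intro A_fm_E_fm_Abar_fm_Ebar_fm.E_lower)
  then have S: "Sdef \<alpha> (fv (Conj \<Phi>)) (sat M (Conj \<Phi>))"
    using Abar_Conj.prems by (intro Sdef_E_fm) auto
  have fin: "finite (fv \<phi>)" if "\<phi> \<in> rcset \<Phi>" for \<phi>
    using finite_subset[of "fv \<phi>" "fv (Conj \<Phi>)"] Abar_Conj.prems(2) that by auto
  show ?case
    by (rule good_Conj[OF S Abar_Conj.prems(2)]) (use fin Abar_Conj in blast)
next
  case (Abar_Disj \<beta> \<Phi>)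
  have fin: "finite (fv \<phi>)" if "\<phi> \<in> rcset \<Phi>" for \<phi>
    using finite_subset[of "fv \<phi>" "fv (Disj \<Phi>)"] Abar_Disj.prems(2) that by auto
  show ?case
    by (rule good_Disj[OF Abar_Disj.prems(2) _ assms]) (use fin Abar_Disj in blast)
next
  case (Ebar_base \<beta> \<phi>)
  then show ?case by (meson less_imp_le order.strict_trans)
next
  case (Ebar_Conj \<beta> \<Phi>)
  obtain \<gamma> where \<gamma>: "\<beta> < \<gamma>" "\<gamma> < \<alpha>" using Ebar_Conj.prems by auto
  have "Ebar_fm L \<beta> (Conj \<Phi>)"
    using Ebar_Conj by (intro A_fm_E_fm_Abar_fm_Ebar_fm.Ebar_Conj) blast+
  \<comment> \<open>At \<open>\<gamma>\<close> the formula counts as universal and defines a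
    \<open>Pdef\<close> set; the second step, from \<open>\<gamma>\<close> to
    \<open>\<alpha>\<close>, makes it open.\<close>
  then have "A_fm L \<gamma> (Conj \<Phi>)"
    using Ebar_Conj \<gamma> by (intro A_fm_E_fm_Abar_fm_Ebar_fm.A_lower)
  then have "Pdef \<gamma> (fv (Conj \<Phi>)) (sat M (Conj \<Phi>))"
    using Ebar_Conj.prems by (intro Pdef_A_fm) auto
  then have S: "Sdef \<alpha> (fv (Conj \<Phi>)) (sat M (Conj \<Phi>))"
    using \<gamma>(2) Ebar_Conj.prems(2) by (rule Sdef_of_Pdef_less)
  have fin: "finite (fv \<phi>)" if "\<phi> \<in> rcset \<Phi>" for \<phi>
    using finite_subset[of "fv \<phi>" "fv (Conj \<Phi>)"] Ebar_Conj.prems(2) that by auto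
  show ?case
    by (rule good_Conj[OF S Ebar_Conj.prems(2)]) (use fin Ebar_Conj in blast)
next
  case (Ebar_Disj \<beta> \<Phi>)
  have fin: "finite (fv \<phi>)" if "\<phi> \<in> rcset \<Phi>" for \<phi>
    using finite_subset[of "fv \<phi>" "fv (Disj \<Phi>)"] Ebar_Disj.prems(2) that by auto
  show ?case
    by (rule good_Disj[OF Ebar_Disj.prems(2) _ assms]) (use fin Ebar_Disj in blast)
qed

section \<open>Conditions and their extensions\<close>

definition cond :: "'o::wellorder \<Rightarrow> (nat \<Rightarrow> 'a) set \<Rightarrow> bool" where
  "cond \<alpha> S \<longleftrightarrow> S \<noteq> {} \<and> (\<exists>D X. finite D \<and> Sdef \<alpha> D X \<and> S = {v \<in> asg. X v})"

lemma cond_inter: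
  assumes "cond \<alpha> S" "Sdef \<alpha> D X" "finite D" "v \<in> S" "X v" "\<not> ord_zero \<alpha>"
  shows "cond \<alpha> {v \<in> S. X v}"
proof -
  obtain D' X' where *: "finite D'" "Sdef \<alpha> D' X'" "S = {v \<in> asg. X' v}"
    using assms(1) by (auto simp: cond_def)
  have "Sdef \<alpha> (D' \<union> D) (\<lambda>v. X' v \<and> X v)"
    using * assms by (intro Sdef_conj)
  moreover have "{v \<in> S. X v} = {v \<in> asg. X' v \<and> X v}" using *(3) by auto
  moreover have "{v \<in> S. X v} \<noteq> {}" using assms by auto
  ultimately show ?thesis
    unfolding cond_def using *(1) assms(3) by (metis finite_UnI)
qed

text \<open>The naming \<open>\<sigma>\<close> sends variables of the formula to the variables
  constrained by conditions. A positive decision also commits to a disjunct, or to a name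
  \<open>k\<close> witnessing an existential quantifier, as in a Henkin construction.\<close>

definition decides :: "'r fm \<Rightarrow> (nat \<Rightarrow> nat) \<Rightarrow> (nat \<Rightarrow> 'a) set \<Rightarrow> bool" where
  "decides \<phi> \<sigma> S \<longleftrightarrow> (\<forall>v\<in>S. \<not> sat M \<phi> (v \<circ> \<sigma>)) \<or>
     (\<forall>v\<in>S. sat M \<phi> (v \<circ> \<sigma>)) \<and>
     (\<forall>\<Phi>. \<phi> = Disj \<Phi> \<longrightarrow> (\<exists>\<psi>\<in>rcset \<Phi>. \<forall>v\<in>S. sat M \<psi> (v \<circ> \<sigma>))) \<and>
     (\<forall>x \<psi>. \<phi> = Ex x \<psi> \<longrightarrow> (\<exists>k. \<forall>v\<in>S. sat M \<psi> (v \<circ> \<sigma>(x := k))))"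

lemma Sdef_sat_rename:
  assumes "good \<alpha> \<phi>"
  shows "Sdef \<alpha> (\<sigma> ` fv \<phi>) (\<lambda>v. sat M \<phi> (v \<circ> \<sigma>))"
  using good_finite[OF assms] good_Sdef[OF assms] by (rule Sdef_rename)

lemma good_subfms: "good \<alpha> \<phi> \<Longrightarrow> \<psi> \<in> subfms \<phi> \<Longrightarrow> good \<alpha> \<psi>"
  using subfms_trans[of \<psi> \<phi>] by (auto simp: good_def)

lemma cond_decides:
  assumes S: "cond \<alpha> S" and \<phi>: "good \<alpha> \<phi>" and \<alpha>: "\<not> ord_zero \<alpha>"
  shows "\<exists>T. cond \<alpha> T \<and> T \<subseteq> S \<and> decides \<phi> \<sigma> T"
proof (cases "\<exists>v\<in>S. sat M \<phi> (v \<circ> \<sigma>)")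
  case False
  then show ?thesis using S by (auto simp: decides_def)
next
  case True
  then obtain v where v: "v \<in> S" "sat M \<phi> (v \<circ> \<sigma>)" by auto
  define S' where "S' = {v \<in> S. sat M \<phi> (v \<circ> \<sigma>)}"
  have fin: "finite (\<sigma> ` fv \<psi>)" if "good \<alpha> \<psi>" for \<sigma> and \<psi> :: "'r fm"
    using good_finite[OF that] by simp
  have S': "cond \<alpha> S'"
    unfolding S'_def using v by (intro cond_inter[OF S Sdef_sat_rename[OF \<phi>] fin[OF \<phi>] _ _ \<alpha>])
  have "v \<in> S'" "S' \<subseteq> S" using v by (auto simp: S'_def)
  consider (disj) \<Phi> where "\<phi> = Disj \<Phi>" | (ex) x \<psi> where "\<phi> = Ex x \<psi>"
    | (other) "\<forall>\<Phi>. \<phi> \<noteq> Disj \<Phi>" "\<forall>x \<psi>. \<phi> \<noteq> Ex x \<psi>" by blast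
  then show ?thesis
  proof cases
    case disj
    then obtain \<psi> where \<psi>: "\<psi> \<in> rcset \<Phi>" "sat M \<psi> (v \<circ> \<sigma>)" using v by auto
    have g: "good \<alpha> \<psi>"
      by (rule good_subfms[OF \<phi>]) (use disj \<psi> subfms_refl in \<open>auto simp: rcset_cimage\<close>)
    have "cond \<alpha> {v \<in> S'. sat M \<psi> (v \<circ> \<sigma>)}"
      using \<psi> \<open>v \<in> S'\<close> by (intro cond_inter[OF S' Sdef_sat_rename[OF g] fin[OF g] _ _ \<alpha>])
    then show ?thesis
      using \<psi> disj by (intro exI[of _ "{v \<in> S'. sat M \<psi> (v \<circ> \<sigma>)}"]) (auto simp: decides_def S'_def)
  next
    case ex
    then obtain a where a: "a \<in> carrier M" "sat M \<psi> ((v \<circ> \<sigma>)(x := a))" using v by auto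
    have g: "good \<alpha> \<psi>"
      by (rule good_subfms[OF \<phi>]) (use ex subfms_refl in auto)
    obtain D X where D: "finite D" "Sdef \<alpha> D X" "S' = {v \<in> asg. X v}"
      using S' by (auto simp: cond_def)
    \<comment> \<open>A name constrained neither by \<open>S'\<close> nor in use under
      \<open>\<sigma>\<close> can be given the value \<open>a\<close> without leaving
      \<open>S'\<close>; it exists because a condition depends on finitely many variables.\<close>
    obtain k where k: "k \<notin> D \<union> \<sigma> ` fv \<psi>"
      using ex_new_if_finite[of "D \<union> \<sigma> ` fv \<psi>"] D(1) fin[OF g] by auto
    define w where "w = v(k := a)"
    have "v \<in> asg" "X v" using \<open>v \<in> S'\<close> D(3) by auto
    then have "w \<in> asg" using a by (auto simp: w_def intro: asgI)
    have "X v \<longleftrightarrow> X w"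
      using k by (intro Sdef_depends[OF D(2) \<open>v \<in> asg\<close> \<open>w \<in> asg\<close>]) (auto simp: w_def)
    then have "w \<in> S'" using D(3) \<open>X v\<close> \<open>w \<in> asg\<close> by auto
    have "sat M \<psi> (w \<circ> \<sigma>(x := k)) \<longleftrightarrow> sat M \<psi> ((v \<circ> \<sigma>)(x := a))"
      by (rule sat_cong) (use k in \<open>auto simp: w_def\<close>)
    then have "cond \<alpha> {v \<in> S'. sat M \<psi> (v \<circ> \<sigma>(x := k))}"
      using a \<open>w \<in> S'\<close> by (intro cond_inter[OF S' Sdef_sat_rename[OF g] fin[OF g] _ _ \<alpha>]) auto
    then show ?thesis
      using ex by (intro exI[of _ "{v \<in> S'. sat M \<psi> (v \<circ> \<sigma>(x := k))}"])
        (auto simp: decides_def S'_def simp del: fun_upd_apply)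
  next
    case other
    then show ?thesis using S' \<open>S' \<subseteq> S\<close> by (intro exI[of _ S']) (auto simp: decides_def S'_def)
  qed
qed

end

section \<open>The generic structure\<close>

text \<open>The Rasiowa-Sikorski argument: the requirement with index \<open>n\<close> in an
  enumeration is met at stage \<open>n + 1\<close>.\<close>

lemma generic_sequence:
  fixes C :: "'b set \<Rightarrow> bool"
  assumes "countable \<D>" "C p"
    and dense: "\<And>D p. D \<in> \<D> \<Longrightarrow> C p \<Longrightarrow> \<exists>q. C q \<and> q \<subseteq> p \<and> D q"
  shows "\<exists>S :: nat \<Rightarrow> 'b set. (\<forall>n. C (S n)) \<and> antimono S \<and> (\<forall>D\<in>\<D>. \<exists>n. D (S n))"
proof (cases "\<D> = {}")
  case True
  then show ?thesis using assms(2) by (intro exI[of _ "\<lambda>_. p"]) (auto simp: antimono_def)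
next
  case False
  have "\<exists>S. \<forall>n. C (S n) \<and> (S (Suc n) \<subseteq> S n \<and> from_nat_into \<D> n (S (Suc n)))"
    by (rule dependent_nat_choice) (use assms(2) dense from_nat_into[OF False] in blast)+
  then obtain S where S: "\<And>n. C (S n)" "\<And>n. S (Suc n) \<subseteq> S n"
    "\<And>n. from_nat_into \<D> n (S (Suc n))" by blast
  have "antimono S"
    by (rule antimonoI) (rule lift_Suc_antimono_le[of S, OF S(2)])
  moreover have "\<exists>n. D (S n)" if "D \<in> \<D>" for D
    using from_nat_into_surj[OF assms(1) that] S(3) by metis
  ultimately show ?thesis using S(1) by blast
qed

text \<open>Only finitely many values of a naming matter to a formula with finitely many free
  variables. Fixing the default name 0 leaves countably many namings, hence countably many
  requirements.\<close>

definition eventually_zero :: "(nat \<Rightarrow> nat) set" where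
  "eventually_zero = {\<sigma>. finite {x. \<sigma> x \<noteq> 0}}"

lemma countable_eventually_zero: "countable eventually_zero"
proof -
  have "\<sigma> \<in> range (\<lambda>l x. if x < length l then l ! x else 0)" if "\<sigma> \<in> eventually_zero" for \<sigma>
  proof -
    obtain N where N: "\<And>x. \<sigma> x \<noteq> 0 \<Longrightarrow> x < N"
      using \<open>\<sigma> \<in> eventually_zero\<close> finite_nat_set_iff_bounded[of "{x. \<sigma> x \<noteq> 0}"]
      by (auto simp: eventually_zero_def)
    have "\<sigma> = (\<lambda>x. if x < length (map \<sigma> [0..<N]) then map \<sigma> [0..<N] ! x else 0)"
      using N by fastforce
    then show ?thesis by (rule range_eqI)
  qed
  then show ?thesis
    by (meson countable_image countableI_type countable_subset subsetI)
qed

lemma eventually_zero_upd: "\<sigma> \<in> eventually_zero \<Longrightarrow> \<sigma>(x := k) \<in> eventually_zero"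
proof -
  assume "\<sigma> \<in> eventually_zero"
  then have "finite (insert x {y. \<sigma> y \<noteq> 0})" by (simp add: eventually_zero_def)
  moreover have "{y. (\<sigma>(x := k)) y \<noteq> 0} \<subseteq> insert x {y. \<sigma> y \<noteq> 0}" by auto
  ultimately show ?thesis
    unfolding eventually_zero_def by (blast intro: finite_subset)
qed

lemma eventually_zero_restrict:
  "finite D \<Longrightarrow> (\<lambda>x. if x \<in> D then \<sigma> x else 0) \<in> eventually_zero"
  unfolding eventually_zero_def by (auto elim!: finite_subset[rotated])

lemma comp_fun_upd: "f \<circ> \<sigma>(x := k) = (f \<circ> \<sigma>)(x := f k)"
  by auto

locale generic_filter = countable_structure L M
  for L :: "'r language" and M :: "('a, 'r) fo_struct" +
  fixes S :: "nat \<Rightarrow> (nat \<Rightarrow> 'a) set" and F :: "'r fm set"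
  assumes S_nonempty: "S n \<noteq> {}"
    and S_asg: "S n \<subseteq> asg"
    and antimono_S: "antimono S"
    and S_decides: "\<phi> \<in> F \<Longrightarrow> \<sigma> \<in> eventually_zero \<Longrightarrow> \<exists>n. decides \<phi> \<sigma> (S n)"
    and Neg_qf: "Neg \<phi> \<in> F \<Longrightarrow> qf_fm L \<phi>"
begin

section \<open>Forced statements and the structure of names\<close>

definition forced :: "((nat \<Rightarrow> 'a) \<Rightarrow> bool) \<Rightarrow> bool" where
  "forced P \<longleftrightarrow> (\<exists>n. \<forall>v\<in>S n. P v)"

lemma forced_mono:
  assumes "forced P" "\<And>v. v \<in> asg \<Longrightarrow> P v \<Longrightarrow> Q v"
  shows "forced Q"
proof -
  obtain n where n: "\<forall>v\<in>S n. P v" using assms(1) unfolding forced_def by (rule exE)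
  then have "\<forall>v\<in>S n. Q v" using assms(2) S_asg by auto
  then show ?thesis unfolding forced_def by (rule exI)
qed

lemma forced_finite_Ball:
  assumes "finite A" "\<And>a. a \<in> A \<Longrightarrow> forced (P a)"
  shows "forced (\<lambda>v. \<forall>a\<in>A. P a v)"
proof -
  obtain n where n: "\<And>a v. a \<in> A \<Longrightarrow> v \<in> S (n a) \<Longrightarrow> P a v"
    using assms(2) unfolding forced_def by metis
  \<comment> \<open>The last of finitely many stages serves for all; for empty \<open>A\<close> the
    value of \<open>Max\<close> is arbitrary and nothing is claimed.\<close>
  have "S (Max (n ` A)) \<subseteq> S (n a)" if "a \<in> A" for a
    using assms(1) that by (intro antimonoD[OF antimono_S]) auto
  then have "\<forall>v\<in>S (Max (n ` A)). \<forall>a\<in>A. P a v" using n by auto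
  then show ?thesis unfolding forced_def by (rule exI)
qed

lemma forced_conj:
  assumes "forced P" "forced Q"
  shows "forced (\<lambda>v. P v \<and> Q v)"
proof -
  have "forced (\<lambda>v. \<forall>X\<in>{P, Q}. X v)"
    by (rule forced_finite_Ball) (use assms in auto)
  then show ?thesis by simp
qed

lemma forced_consistent:
  assumes "forced P"
  shows "\<exists>v\<in>asg. P v"
proof -
  obtain n where n: "\<forall>v\<in>S n. P v" using assms unfolding forced_def by (rule exE)
  obtain v where "v \<in> S n" using S_nonempty by auto
  then show ?thesis using n S_asg by auto
qed

text \<open>Forced equality is an equivalence relation on names; least representatives realise the
  quotient inside \<open>nat\<close>.\<close>

definition rep :: "nat \<Rightarrow> nat" where
  "rep i = (LEAST j. forced (\<lambda>v. v j = v i))"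

definition N :: "(nat, 'r) fo_struct" where
  "N = \<lparr>carrier = range rep,
        interp = \<lambda>r. {map rep cs |cs. forced (\<lambda>v. map v cs \<in> interp M r)}\<rparr>"

lemma forced_rep: "forced (\<lambda>v. v (rep i) = v i)"
  unfolding rep_def by (rule LeastI[of "\<lambda>j. forced (\<lambda>v. v j = v i)" i]) (simp add: forced_def)

lemma rep_eq_iff: "rep i = rep j \<longleftrightarrow> forced (\<lambda>v. v i = v j)"
proof
  assume "rep i = rep j"
  then have "forced (\<lambda>v. v (rep i) = v i \<and> v (rep i) = v j)"
    using forced_conj[OF forced_rep[of i] forced_rep[of j]] by simp
  then show "forced (\<lambda>v. v i = v j)" by (rule forced_mono) auto
next
  assume *: "forced (\<lambda>v. v i = v j)"
  have "forced (\<lambda>v. v k = v i) \<longleftrightarrow> forced (\<lambda>v. v k = v j)" for k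
  proof
    assume "forced (\<lambda>v. v k = v i)"
    from forced_conj[OF this *] show "forced (\<lambda>v. v k = v j)" by (rule forced_mono) auto
  next
    assume "forced (\<lambda>v. v k = v j)"
    from forced_conj[OF this *] show "forced (\<lambda>v. v k = v i)" by (rule forced_mono) auto
  qed
  then show "rep i = rep j" by (simp add: rep_def)
qed

lemma rep_rep: "rep (rep i) = rep i"
  unfolding rep_eq_iff by (rule forced_rep)

lemma structure_N: "structure_for L N"
proof -
  have "length cs = n" if r: "L r = Some n" "forced (\<lambda>v. map v cs \<in> interp M r)" for r n cs
  proof -
    obtain v where "map v cs \<in> interp M r" using forced_consistent[OF r(2)] by auto
    then have "length (map v cs) = n"
      using structure_M r(1) unfolding structure_for_def by blast
    then show ?thesis by simp
  qed
  then show ?thesis by (auto simp: structure_for_def N_def)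
qed

lemma truth_Eq: "sat N (Eq x y) (rep \<circ> \<sigma>) \<longleftrightarrow> forced (\<lambda>v. sat M (Eq x y) (v \<circ> \<sigma>))"
  by (simp add: rep_eq_iff)

text \<open>Two tuples of names for the same elements differ by finitely many forced equalities,
  which hold together at one stage; so the tuple \<open>cs\<close> behind membership in
  \<open>interp N r\<close> does not matter.\<close>

lemma truth_Rel: "sat N (Rel r xs) (rep \<circ> \<sigma>) \<longleftrightarrow> forced (\<lambda>v. sat M (Rel r xs) (v \<circ> \<sigma>))"
proof
  assume "sat N (Rel r xs) (rep \<circ> \<sigma>)"
  then obtain cs where cs: "map rep (map \<sigma> xs) = map rep cs" "forced (\<lambda>v. map v cs \<in> interp M r)"
    by (auto simp: N_def)
  have len: "length cs = length xs" using cs(1) by (metis length_map)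
  have "forced (\<lambda>v. \<forall>i\<in>{..<length xs}. v (cs ! i) = v (\<sigma> (xs ! i)))"
  proof (rule forced_finite_Ball)
    fix i assume "i \<in> {..<length xs}"
    then have "rep (cs ! i) = rep (\<sigma> (xs ! i))"
      using len arg_cong[OF cs(1), of "\<lambda>l. l ! i"] by simp
    then show "forced (\<lambda>v. v (cs ! i) = v (\<sigma> (xs ! i)))" by (simp add: rep_eq_iff)
  qed simp
  from forced_conj[OF this cs(2)] show "forced (\<lambda>v. sat M (Rel r xs) (v \<circ> \<sigma>))"
  proof (rule forced_mono)
    fix v assume *: "(\<forall>i\<in>{..<length xs}. v (cs ! i) = v (\<sigma> (xs ! i))) \<and> map v cs \<in> interp M r"
    then have "map v cs = map (v \<circ> \<sigma>) xs" using len by (intro nth_equalityI) auto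
    then show "sat M (Rel r xs) (v \<circ> \<sigma>)" using * by simp
  qed
next
  assume "forced (\<lambda>v. sat M (Rel r xs) (v \<circ> \<sigma>))"
  then have "map rep (map \<sigma> xs) \<in> interp N r"
    unfolding N_def by (auto intro!: exI[of _ "map \<sigma> xs"])
  then show "sat N (Rel r xs) (rep \<circ> \<sigma>)" by simp
qed

lemma forced_dichotomy:
  assumes "\<phi> \<in> F" "\<sigma> \<in> eventually_zero" "\<not> forced (\<lambda>v. sat M \<phi> (v \<circ> \<sigma>))"
  shows "forced (\<lambda>v. \<not> sat M \<phi> (v \<circ> \<sigma>))"
proof -
  obtain n where "decides \<phi> \<sigma> (S n)" using S_decides[OF assms(1,2)] by auto
  then show ?thesis using assms(3) unfolding decides_def forced_def by metis
qed

lemma not_forced_both: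
  assumes "forced P" "forced (\<lambda>v. \<not> P v)"
  shows False
  using forced_consistent[OF forced_conj[OF assms]] by auto

lemma forced_Disj:
  assumes "Disj \<Phi> \<in> F" "\<sigma> \<in> eventually_zero" "forced (\<lambda>v. sat M (Disj \<Phi>) (v \<circ> \<sigma>))"
  obtains \<psi> where "\<psi> \<in> rcset \<Phi>" "forced (\<lambda>v. sat M \<psi> (v \<circ> \<sigma>))"
proof -
  obtain n where "decides (Disj \<Phi>) \<sigma> (S n)" using S_decides[OF assms(1,2)] by auto
  moreover have "\<not> (\<forall>v\<in>S n. \<not> sat M (Disj \<Phi>) (v \<circ> \<sigma>))"
    using not_forced_both[OF assms(3)] unfolding forced_def by metis
  ultimately show ?thesis using that unfolding decides_def forced_def by metis
qed

lemma forced_Ex: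
  assumes "Ex x \<psi> \<in> F" "\<sigma> \<in> eventually_zero" "forced (\<lambda>v. sat M (Ex x \<psi>) (v \<circ> \<sigma>))"
  obtains k where "forced (\<lambda>v. sat M \<psi> (v \<circ> \<sigma>(x := k)))"
proof -
  obtain n where "decides (Ex x \<psi>) \<sigma> (S n)" using S_decides[OF assms(1,2)] by auto
  moreover have "\<not> (\<forall>v\<in>S n. \<not> sat M (Ex x \<psi>) (v \<circ> \<sigma>))"
    using not_forced_both[OF assms(3)] unfolding forced_def by metis
  ultimately show ?thesis using that unfolding decides_def forced_def by metis
qed

text \<open>Negation needs both directions. They are available here because failure is forced
  whenever truth is not, and because a finite conjunction can be forced at a single stage.\<close>

lemma truth_qf:
  "qf_fm L \<phi> \<Longrightarrow> subfms \<phi> \<subseteq> F \<Longrightarrow> \<sigma> \<in> eventually_zero \<Longrightarrow>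
    sat N \<phi> (rep \<circ> \<sigma>) \<longleftrightarrow> forced (\<lambda>v. sat M \<phi> (v \<circ> \<sigma>))"
proof (induction rule: qf_fm.induct)
  case (qf_Eq x y)
  show ?case by (rule truth_Eq)
next
  case (qf_Rel r xs)
  show ?case by (rule truth_Rel)
next
  case (qf_Neg \<phi>)
  then have F: "\<phi> \<in> F" and IH: "sat N \<phi> (rep \<circ> \<sigma>) \<longleftrightarrow> forced (\<lambda>v. sat M \<phi> (v \<circ> \<sigma>))"
    using subfms_refl[of \<phi>] by (auto simp: comp_def)
  show ?case
    using IH forced_dichotomy[OF F qf_Neg.prems(2)] not_forced_both[of "\<lambda>v. sat M \<phi> (v \<circ> \<sigma>)"]
    by (auto simp: comp_def)
next
  case (qf_Conj \<Phi>)
  have IH: "sat N \<phi> (rep \<circ> \<sigma>) \<longleftrightarrow> forced (\<lambda>v. sat M \<phi> (v \<circ> \<sigma>))" if "\<phi> \<in> rcset \<Phi>" for \<phi>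
    using qf_Conj that by (auto simp: rcset_cimage comp_def)
  show ?case
  proof
    assume "sat N (Conj \<Phi>) (rep \<circ> \<sigma>)"
    then have "forced (\<lambda>v. \<forall>\<phi>\<in>rcset \<Phi>. sat M \<phi> (v \<circ> \<sigma>))"
      using IH by (intro forced_finite_Ball qf_Conj.hyps) (auto simp: comp_def)
    then show "forced (\<lambda>v. sat M (Conj \<Phi>) (v \<circ> \<sigma>))" by simp
  next
    assume *: "forced (\<lambda>v. sat M (Conj \<Phi>) (v \<circ> \<sigma>))"
    have "sat N \<phi> (rep \<circ> \<sigma>)" if "\<phi> \<in> rcset \<Phi>" for \<phi>
      unfolding IH[OF that] using * by (rule forced_mono) (use that in \<open>auto simp: comp_def\<close>)
    then show "sat N (Conj \<Phi>) (rep \<circ> \<sigma>)" by simp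
  qed
next
  case (qf_Disj \<Phi>)
  have IH: "sat N \<phi> (rep \<circ> \<sigma>) \<longleftrightarrow> forced (\<lambda>v. sat M \<phi> (v \<circ> \<sigma>))" if "\<phi> \<in> rcset \<Phi>" for \<phi>
    using qf_Disj that by (auto simp: rcset_cimage comp_def)
  show ?case
  proof
    assume "sat N (Disj \<Phi>) (rep \<circ> \<sigma>)"
    then obtain \<phi> where \<phi>: "\<phi> \<in> rcset \<Phi>" "sat N \<phi> (rep \<circ> \<sigma>)" by (auto simp: comp_def)
    then have "forced (\<lambda>v. sat M \<phi> (v \<circ> \<sigma>))" using IH by simp
    then show "forced (\<lambda>v. sat M (Disj \<Phi>) (v \<circ> \<sigma>))" by (rule forced_mono) (use \<phi> in \<open>auto simp: comp_def\<close>)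
  next
    assume *: "forced (\<lambda>v. sat M (Disj \<Phi>) (v \<circ> \<sigma>))"
    have "Disj \<Phi> \<in> F" using qf_Disj.prems by simp
    from forced_Disj[OF this qf_Disj.prems(2) *] obtain \<psi>
      where "\<psi> \<in> rcset \<Phi>" "forced (\<lambda>v. sat M \<psi> (v \<circ> \<sigma>))" by blast
    then show "sat N (Disj \<Phi>) (rep \<circ> \<sigma>)" using IH by (auto simp: comp_def)
  qed
qed

text \<open>The conjuncts of an infinite conjunction may be forced at different stages with no
  common one, and likewise the instances of a universal formula; hence only this direction. Forcing
  passes down to conjuncts and instances, and \<open>decides\<close> supplies a disjunct or a
  name.\<close>

lemma truth:
  "subfms \<phi> \<subseteq> F \<Longrightarrow> \<sigma> \<in> eventually_zero \<Longrightarrow> forced (\<lambda>v. sat M \<phi> (v \<circ> \<sigma>)) \<Longrightarrow>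
    sat N \<phi> (rep \<circ> \<sigma>)"
proof (induction \<phi> arbitrary: \<sigma>)
  case (Eq x y)
  from Eq.prems(3) show ?case by (rule iffD2[OF truth_Eq])
next
  case (Rel r xs)
  from Rel.prems(3) show ?case by (rule iffD2[OF truth_Rel])
next
  case (Neg \<phi>)
  then have "qf_fm L (Neg \<phi>)" using Neg_qf by (auto intro: qf_fm.intros)
  from truth_qf[OF this Neg.prems(1,2)] show ?case using Neg.prems(3) by (rule iffD2)
next
  case (Conj \<Phi>)
  have "sat N \<phi> (rep \<circ> \<sigma>)" if "\<phi> \<in> rcset \<Phi>" for \<phi>
  proof (rule Conj.IH[OF that _ Conj.prems(2)])
    show "forced (\<lambda>v. sat M \<phi> (v \<circ> \<sigma>))"
      using Conj.prems(3) by (rule forced_mono) (use that in \<open>auto simp: comp_def\<close>)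
  qed (use Conj.prems that in \<open>auto simp: rcset_cimage\<close>)
  then show ?case by (simp add: comp_def)
next
  case (Disj \<Phi>)
  have "Disj \<Phi> \<in> F" using Disj.prems by simp
  from forced_Disj[OF this Disj.prems(2,3)] obtain \<psi>
    where \<psi>: "\<psi> \<in> rcset \<Phi>" "forced (\<lambda>v. sat M \<psi> (v \<circ> \<sigma>))" by blast
  have "sat N \<psi> (rep \<circ> \<sigma>)"
    by (rule Disj.IH[OF \<psi>(1) _ Disj.prems(2) \<psi>(2)])
      (use Disj.prems(1) \<psi>(1) in \<open>auto simp: rcset_cimage\<close>)
  then show ?case using \<psi>(1) by (auto simp: comp_def)
next
  case (Ex x \<phi>)
  have "Ex x \<phi> \<in> F" using Ex.prems by simp
  from forced_Ex[OF this Ex.prems(2,3)] obtain k where k: "forced (\<lambda>v. sat M \<phi> (v \<circ> \<sigma>(x := k)))"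
    by blast
  have "sat N \<phi> (rep \<circ> \<sigma>(x := k))"
    by (rule Ex.IH[OF _ eventually_zero_upd[OF Ex.prems(2)] k]) (use Ex.prems in auto)
  moreover have "rep k \<in> carrier N" by (simp add: N_def)
  ultimately show ?case unfolding comp_fun_upd sat.simps by (rule bexI)
next
  case (All x \<phi>)
  have "sat N \<phi> ((rep \<circ> \<sigma>)(x := rep k))" for k
  proof -
    have k: "forced (\<lambda>v. sat M \<phi> (v \<circ> \<sigma>(x := k)))"
      using All.prems(3)
    proof (rule forced_mono)
      fix v assume "v \<in> asg" "sat M (All x \<phi>) (v \<circ> \<sigma>)"
      then show "sat M \<phi> (v \<circ> \<sigma>(x := k))"
        unfolding comp_fun_upd sat.simps using asg_app by blast
    qed
    have "sat N \<phi> (rep \<circ> \<sigma>(x := k))"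
      by (rule All.IH[OF _ eventually_zero_upd[OF All.prems(2)] k]) (use All.prems(1) in auto)
    then show ?thesis unfolding comp_fun_upd .
  qed
  then have "sat N \<phi> ((rep \<circ> \<sigma>)(x := a))" if "a \<in> range rep" for a
    using that by (elim rangeE) simp
  then show ?case unfolding sat.simps by (simp add: N_def)
qed

end

section \<open>Omitting the types\<close>

lemma sat_tuple_iff:
  assumes "fv \<phi> \<subseteq> set xs" "length as = length xs"
    and "\<And>x. x \<in> set xs \<Longrightarrow> v x = the (map_of (zip xs as) x)"
  shows "sat_tuple M xs \<phi> as \<longleftrightarrow> sat M \<phi> v"
  unfolding sat_tuple_def by (rule sat_cong) (use assms in auto)

lemma map_of_zip_in_set:
  assumes "length as = length xs" "x \<in> set xs"
  shows "the (map_of (zip xs as) x) \<in> set as"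
proof -
  obtain a where a: "map_of (zip xs as) x = Some a"
    using assms by (metis map_of_zip_is_Some)
  then have "(x, a) \<in> set (zip xs as)" by (rule map_of_SomeD)
  then show ?thesis using a by (auto dest: set_zip_rightD)
qed

lemma map_of_zip_map_the: "x \<in> set xs \<Longrightarrow> the (map_of (zip xs (map f xs)) x) = f x"
  by (simp add: map_of_zip_map)

text \<open>In \<open>M\<close> a tuple satisfies the chosen formulas exactly if it satisfies all of
  \<open>\<Gamma>\<close>, so both sets are supported by the same formulas. A structure omitting the
  smaller set omits \<open>\<Gamma>\<close> as well.\<close>

lemma countable_unsupported_subtype:
  assumes "countable (carrier M)" "\<not> Sigma_supported L \<alpha> M xs \<Gamma>"
  shows "\<exists>\<Gamma>'\<subseteq>\<Gamma>. countable \<Gamma>' \<and> \<not> Sigma_supported L \<alpha> M xs \<Gamma>'"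
proof -
  define B where "B = {as \<in> tuples M (length xs). \<exists>\<gamma>\<in>\<Gamma>. \<not> sat_tuple M xs \<gamma> as}"
  have "\<forall>as\<in>B. \<exists>\<gamma>. \<gamma> \<in> \<Gamma> \<and> \<not> sat_tuple M xs \<gamma> as" by (auto simp: B_def)
  from bchoice[OF this] obtain f where f: "\<And>as. as \<in> B \<Longrightarrow> f as \<in> \<Gamma> \<and> \<not> sat_tuple M xs (f as) as"
    by blast
  have "tuples M (length xs) \<subseteq> lists (carrier M)" by (auto simp: tuples_def)
  then have "B \<subseteq> lists (carrier M)" by (auto simp: B_def)
  then have "countable B" using countable_lists[OF assms(1)] by (rule countable_subset)
  moreover have "f ` B \<subseteq> \<Gamma>" using f by auto
  moreover have "\<not> Sigma_supported L \<alpha> M xs (f ` B)"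
  proof
    assume "Sigma_supported L \<alpha> M xs (f ` B)"
    then obtain \<theta> where \<theta>: "Sigma_fm L \<alpha> \<theta>" "fv \<theta> \<subseteq> set xs"
      "\<exists>as\<in>tuples M (length xs). sat_tuple M xs \<theta> as"
      "\<And>as \<gamma>. as \<in> tuples M (length xs) \<Longrightarrow> sat_tuple M xs \<theta> as \<Longrightarrow> \<gamma> \<in> f ` B \<Longrightarrow> sat_tuple M xs \<gamma> as"
      unfolding Sigma_supported_def by blast
    have "sat_tuple M xs \<gamma> as" if "as \<in> tuples M (length xs)" "sat_tuple M xs \<theta> as" "\<gamma> \<in> \<Gamma>" for as \<gamma>
    proof (rule ccontr)
      assume "\<not> sat_tuple M xs \<gamma> as"
      then have B: "as \<in> B" using that by (auto simp: B_def)
      then show False using f[OF B] \<theta>(4)[OF that(1,2)] by auto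
    qed
    then show False using assms(2) \<theta>(1-3) unfolding Sigma_supported_def by blast
  qed
  ultimately show ?thesis by (intro exI[of _ "f ` B"]) simp
qed

context countable_structure
begin

text \<open>A condition constrains the tuple named by \<open>\<sigma>\<close> through its image under \<open>v \<mapsto> v \<circ> \<sigma>\<close>, which is
  again $\Sigma_\alpha$-definable and therefore cannot support the type.\<close>

lemma cond_avoids_type:
  assumes S: "cond \<alpha> S" and \<alpha>: "\<not> ord_zero \<alpha>" and type: "Pi_type L \<alpha> xs \<Gamma>"
    and unsupp: "\<not> Sigma_supported L \<alpha> M xs \<Gamma>"
  shows "\<exists>\<gamma>\<in>\<Gamma>. \<exists>v\<in>S. \<not> sat M \<gamma> (v \<circ> \<sigma>)"
proof -
  obtain a where a: "a \<in> carrier M" using asg_nonempty by auto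
  obtain D X where D: "finite D" "Sdef \<alpha> D X" "S = {v \<in> asg. X v}"
    using S by (auto simp: cond_def)
  obtain K where K: "\<And>x. x \<in> set xs \<Longrightarrow> x < K"
    using finite_nat_set_iff_bounded[of "set xs"] by auto
  \<comment> \<open>Shifting by a bound \<open>K\<close> of \<open>xs\<close> copies the variables
    of the condition beyond those of the type; \<open>\<epsilon>\<close> then ties each
    \<open>x\<close> in \<open>xs\<close> to the copy of its name \<open>\<sigma> x\<close>. This
    works even if \<open>\<sigma>\<close> repeats names or takes values in
    \<open>xs\<close>.\<close>
  define \<tau> where "\<tau> x = x + K" for x
  define \<epsilon> :: "'r fm" where "\<epsilon> = Conj (acset ((\<lambda>x. Eq x (\<tau> (\<sigma> x))) ` set xs))"
  have rc: "rcset (acset ((\<lambda>x. Eq x (\<tau> (\<sigma> x)) :: 'r fm) ` set xs)) = (\<lambda>x. Eq x (\<tau> (\<sigma> x))) ` set xs"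
    by (simp add: countable_finite)
  have \<epsilon>: "qf_fm L \<epsilon>" "finite (fv \<epsilon>)"
    unfolding \<epsilon>_def by (rule qf_fm.intros) (auto simp: rc intro: qf_fm.intros)
  have sat_\<epsilon>: "sat M \<epsilon> u \<longleftrightarrow> (\<forall>x\<in>set xs. u x = u (\<tau> (\<sigma> x)))" for u
    unfolding \<epsilon>_def by (simp add: rc)
  define E where "E = \<tau> ` D \<union> fv \<epsilon> \<union> set xs"
  have "finite E" using D \<epsilon> by (simp add: E_def)
  have "Sdef \<alpha> (\<tau> ` D \<union> fv \<epsilon>) (\<lambda>u. X (u \<circ> \<tau>) \<and> sat M \<epsilon> u)"
    using D \<epsilon> \<alpha> by (intro Sdef_conj Sdef_rename Sdef_qf_fm) auto
  then have "Sdef \<alpha> E (\<lambda>u. X (u \<circ> \<tau>) \<and> sat M \<epsilon> u)"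
    by (rule Sdef_mono) (auto simp: E_def)
  then have "Sdef \<alpha> (set xs) (\<lambda>u. \<exists>w\<in>asg. (\<forall>x\<in>set xs. u x = w x) \<and> (X (w \<circ> \<tau>) \<and> sat M \<epsilon> w))"
    using \<alpha> \<open>finite E\<close> by (rule Sdef_project) (auto simp: E_def)
  then obtain \<theta> where \<theta>: "Sigma_fm L \<alpha> \<theta>" "fv \<theta> \<subseteq> set xs"
    "\<And>u. u \<in> asg \<Longrightarrow> sat M \<theta> u \<longleftrightarrow>
      (\<exists>w\<in>asg. (\<forall>x\<in>set xs. u x = w x) \<and> (X (w \<circ> \<tau>) \<and> sat M \<epsilon> w))"
    unfolding Sdef_def by blast
  define val where "val as x = (if x \<in> set xs then the (map_of (zip xs as) x) else a)" for as x
  have val_asg: "val as \<in> asg" if "as \<in> tuples M (length xs)" for as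
    using that a map_of_zip_in_set[of as xs] by (intro asgI) (auto simp: val_def tuples_def)
  have sat_val: "sat_tuple M xs \<phi> as \<longleftrightarrow> sat M \<phi> (val as)"
    if "fv \<phi> \<subseteq> set xs" "as \<in> tuples M (length xs)" for \<phi> :: "'r fm" and as
    using that by (intro sat_tuple_iff) (auto simp: val_def tuples_def)
  obtain v where v: "v \<in> S" "v \<in> asg" "X v" using S D(3) by (auto simp: cond_def)
  define bs where "bs = map (v \<circ> \<sigma>) xs"
  have bs: "bs \<in> tuples M (length xs)" using v(2) by (auto simp: bs_def tuples_def)
  have val_bs: "val bs x = v (\<sigma> x)" if "x \<in> set xs" for x
    using that by (simp add: val_def bs_def map_of_zip_map_the)
  have "sat M \<theta> (val bs)"
  proof -
    \<comment> \<open>The point \<open>v\<close> of the condition shows that \<open>\<theta>\<close>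
      is satisfied: \<open>w\<close> carries the tuple \<open>bs\<close> below \<open>K\<close> and
      a copy of \<open>v\<close> from \<open>K\<close> on.\<close>
    define w where "w x = (if x < K then val bs x else v (x - K))" for x
    have "w \<in> asg" using val_asg[OF bs] v(2) by (auto intro!: asgI simp: w_def)
    moreover have "w \<circ> \<tau> = v" by (auto simp: w_def \<tau>_def)
    moreover have "sat M \<epsilon> w" using K val_bs by (auto simp: sat_\<epsilon> w_def \<tau>_def)
    moreover have "\<forall>x\<in>set xs. val bs x = w x" using K by (auto simp: w_def)
    ultimately show ?thesis
      unfolding \<theta>(3)[OF val_asg[OF bs]] using v(3) by (intro bexI[of _ w]) auto
  qed
  then have "sat_tuple M xs \<theta> bs" using sat_val[OF \<theta>(2) bs] by simp
  then obtain as \<gamma> where as: "as \<in> tuples M (length xs)" "sat_tuple M xs \<theta> as" "\<gamma> \<in> \<Gamma>"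
    "\<not> sat_tuple M xs \<gamma> as"
    using unsupp \<theta>(1,2) bs unfolding Sigma_supported_def by blast
  have fv\<gamma>: "fv \<gamma> \<subseteq> set xs" using type as(3) by (auto simp: Pi_type_def)
  have "sat M \<theta> (val as)" using sat_val[OF \<theta>(2) as(1)] as(2) by simp
  then obtain w where w: "w \<in> asg" "\<And>x. x \<in> set xs \<Longrightarrow> val as x = w x" "X (w \<circ> \<tau>)" "sat M \<epsilon> w"
    unfolding \<theta>(3)[OF val_asg[OF as(1)]] by blast
  \<comment> \<open>Read through \<open>\<tau>\<close>, the point \<open>w\<close> becomes an
    element of the condition whose values at the names are those of \<open>as\<close>.\<close>
  have "sat M \<gamma> ((w \<circ> \<tau>) \<circ> \<sigma>) \<longleftrightarrow> sat M \<gamma> (val as)"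
    by (rule sat_cong) (use w(2,4) fv\<gamma> in \<open>auto simp: sat_\<epsilon>\<close>)
  then have "\<not> sat M \<gamma> ((w \<circ> \<tau>) \<circ> \<sigma>)" using sat_val[OF fv\<gamma> as(1)] as(4) by simp
  moreover have "w \<circ> \<tau> \<in> S" using w D(3) by auto
  ultimately show ?thesis using as(3) by blast
qed

lemma cond_asg: "\<not> ord_zero \<alpha> \<Longrightarrow> cond \<alpha> asg"
proof -
  assume \<alpha>: "\<not> ord_zero \<alpha>"
  have "Sdef \<alpha> {} (sat M (Conj (acset {})))"
    by (rule Sdef_qf_fm) (use \<alpha> in \<open>auto intro: qf_fm.intros\<close>)
  then have "Sdef \<alpha> {} (\<lambda>_. True)" by (rule Sdef_cong) simp
  moreover obtain a where "a \<in> carrier M" using asg_nonempty by auto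
  then have "(\<lambda>_. a) \<in> asg" by (auto intro: asgI)
  ultimately show ?thesis unfolding cond_def by (intro conjI exI[of _ "{}"] exI[of _ "\<lambda>_. True"]) auto
qed

end

theorem theorem7p6:
  fixes L :: "'r language"
    and M :: "('a, 'r) fo_struct"
    and \<alpha> :: "'o::wellorder"
    and xs :: "nat \<Rightarrow> nat list"
    and \<Gamma> :: "nat \<Rightarrow> 'r fm set"
    and \<chi> :: "'r fm"
  assumes "countable (dom L)"
    and "structure_for L M"
    and "countable (carrier M)"
    and "countable {..<\<alpha>}"
    and "\<not> ord_zero \<alpha>"
    and "\<And>i. Pi_type L \<alpha> (xs i) (\<Gamma> i)"
    and "\<And>i. \<not> Sigma_supported L \<alpha> M (xs i) (\<Gamma> i)"
    and "forall_E_sentence L \<alpha> \<chi>"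
    and "models M \<chi>"
  shows "\<exists>N :: (nat, 'r) fo_struct.
           structure_for L N \<and> models N \<chi> \<and> (\<forall>i. omits N (xs i) (\<Gamma> i))"
proof -
  interpret countable_structure L M
    by unfold_locales fact+
  note \<alpha> = assms(5)
  obtain ys \<phi> where ys: "\<forall>i::nat. E_fm L \<alpha> (\<phi> i) \<and> fv (\<phi> i) \<subseteq> set (ys i)"
    and \<chi>: "\<chi> = Conj (acset (range (\<lambda>i. alls (ys i) (\<phi> i))))"
    using assms(8) unfolding forall_E_sentence_def by (elim exE conjE)
  have \<phi>: "E_fm L \<alpha> (\<phi> i)" "fv (\<phi> i) \<subseteq> set (ys i)" for i using ys by auto
  have rc: "rcset (acset (range (\<lambda>i. alls (ys i) (\<phi> i)))) = range (\<lambda>i. alls (ys i) (\<phi> i))"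
    by simp
  \<comment> \<open>The leading quantifiers are stripped here, since the prefixed formula need not
    be open; its matrix is true at every assignment.\<close>
  have M\<phi>: "sat M (\<phi> i) v" if "v \<in> asg" for i v
  proof -
    have "sat M (alls (ys i) (\<phi> i)) v"
      using assms(9) that unfolding models_def \<chi> sat_Conj_iff rc by (auto simp: asg_def)
    then show ?thesis unfolding sat_alls using that by auto
  qed
  have "\<exists>\<Gamma>'. \<forall>i. \<Gamma>' i \<subseteq> \<Gamma> i \<and> countable (\<Gamma>' i) \<and> \<not> Sigma_supported L \<alpha> M (xs i) (\<Gamma>' i)"
    using countable_unsupported_subtype[OF assms(3) assms(7)] by (intro choice) auto
  then obtain \<Gamma>' where *: "\<forall>i. \<Gamma>' i \<subseteq> \<Gamma> i \<and> countable (\<Gamma>' i) \<and>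
    \<not> Sigma_supported L \<alpha> M (xs i) (\<Gamma>' i)" by (elim exE)
  have \<Gamma>': "\<Gamma>' i \<subseteq> \<Gamma> i" "countable (\<Gamma>' i)" "\<not> Sigma_supported L \<alpha> M (xs i) (\<Gamma>' i)" for i
    using * by auto
  have type: "Pi_type L \<alpha> (xs i) (\<Gamma>' i)" for i
    using assms(6)[of i] \<Gamma>'(1)[of i] by (auto simp: Pi_type_def)
  have good_\<phi>: "good \<alpha> (\<phi> i)" for i
    using \<phi>(1) by (rule good_E_fm[OF \<alpha>]) (auto intro: finite_subset[OF \<phi>(2)])
  have good_\<gamma>: "good \<alpha> (neg \<gamma>)" if "\<gamma> \<in> \<Gamma>' i" for i \<gamma>
  proof -
    have "Pi_fm L \<alpha> \<gamma>" "fv \<gamma> \<subseteq> set (xs i)" using type[of i] that by (auto simp: Pi_type_def)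
    then show ?thesis
      by (intro good_Sigma_fm[OF \<alpha> Sigma_fm_neg]) (auto intro: finite_subset)
  qed
  define F where "F = (\<Union>i. subfms (\<phi> i)) \<union> (\<Union>i. \<Union>\<gamma>\<in>\<Gamma>' i. subfms (neg \<gamma>))"
  have good_F: "good \<alpha> \<psi>" if "\<psi> \<in> F" for \<psi>
    using that good_\<phi> good_\<gamma> good_subfms unfolding F_def by blast
  have "countable F"
    unfolding F_def using \<Gamma>'(2) by (auto intro!: countable_subfms)
  \<comment> \<open>A single \<open>\<gamma>\<close> must fail on the whole condition, so that
    \<open>neg \<gamma>\<close> is forced and \<open>G.truth\<close> applies to it.\<close>
  define avoid where "avoid i \<sigma> S \<longleftrightarrow> (\<exists>\<gamma>\<in>\<Gamma>' i. \<forall>v\<in>S. sat M (neg \<gamma>) (v \<circ> \<sigma>))"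
    for i and \<sigma> :: "nat \<Rightarrow> nat" and S
  define \<D> where "\<D> = (\<lambda>(\<psi>, \<sigma>). decides \<psi> \<sigma>) ` (F \<times> eventually_zero) \<union>
    (\<lambda>(i, \<sigma>). avoid i \<sigma>) ` (UNIV \<times> eventually_zero)"
  have "countable \<D>"
    unfolding \<D>_def using \<open>countable F\<close> countable_eventually_zero
    by (intro countable_Un countable_image countable_SIGMA) auto
  moreover have "\<exists>T. cond \<alpha> T \<and> T \<subseteq> S \<and> R T" if R: "R \<in> \<D>" and S: "cond \<alpha> S" for R S
  proof -
    consider (dec) \<psi> \<sigma> where "\<psi> \<in> F" "R = decides \<psi> \<sigma>" | (av) i \<sigma> where "R = avoid i \<sigma>"
      using R unfolding \<D>_def by auto
    then show ?thesis
    proof cases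
      case dec
      then show ?thesis using cond_decides[OF S good_F \<alpha>] by simp
    next
      case av
      obtain \<gamma> v where \<gamma>: "\<gamma> \<in> \<Gamma>' i" "v \<in> S" "\<not> sat M \<gamma> (v \<circ> \<sigma>)"
        using cond_avoids_type[OF S \<alpha> type \<Gamma>'(3)] by blast
      have "cond \<alpha> {v \<in> S. sat M (neg \<gamma>) (v \<circ> \<sigma>)}"
        by (rule cond_inter[OF S Sdef_sat_rename[OF good_\<gamma>[OF \<gamma>(1)]] _ \<gamma>(2) _ \<alpha>])
          (use \<gamma>(3) good_finite[OF good_\<gamma>[OF \<gamma>(1)]] in auto)
      then show ?thesis
        using \<gamma>(1) by (intro exI[of _ "{v \<in> S. sat M (neg \<gamma>) (v \<circ> \<sigma>)}"]) (auto simp: av avoid_def)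
    qed
  qed
  ultimately have "\<exists>S. (\<forall>n. cond \<alpha> (S n)) \<and> antimono S \<and> (\<forall>R\<in>\<D>. \<exists>n::nat. R (S n))"
    using cond_asg[OF \<alpha>] by (intro generic_sequence)
  then obtain S where **: "(\<forall>n. cond \<alpha> (S n)) \<and> antimono S \<and> (\<forall>R\<in>\<D>. \<exists>n::nat. R (S n))"
    by (elim exE)
  have S: "cond \<alpha> (S n)" "antimono S" "R \<in> \<D> \<Longrightarrow> \<exists>n. R (S n)" for n R
    using ** by auto
  interpret G: generic_filter L M S F
  proof
    show "S n \<noteq> {}" "S n \<subseteq> asg" for n using S(1)[of n] by (auto simp: cond_def)
    show "antimono S" by fact
    show "\<exists>n. decides \<psi> \<sigma> (S n)" if "\<psi> \<in> F" "\<sigma> \<in> eventually_zero" for \<psi> \<sigma>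
      using that by (intro S(3)) (auto simp: \<D>_def)
    show "qf_fm L \<psi>" if "Neg \<psi> \<in> F" for \<psi>
      using good_F[OF that] by (auto simp: good_def)
  qed
  have "models G.N \<chi>"
    unfolding models_def \<chi> sat_Conj_iff rc
  proof (intro allI impI ballI)
    fix v :: "nat \<Rightarrow> nat" and \<psi> assume "range v \<subseteq> carrier G.N" and "\<psi> \<in> range (\<lambda>i. alls (ys i) (\<phi> i))"
    then obtain i where i: "\<psi> = alls (ys i) (\<phi> i)" by auto
    show "sat G.N \<psi> v"
      unfolding i sat_alls
    proof (intro allI impI)
      fix w assume w: "\<forall>x. x \<notin> set (ys i) \<longrightarrow> w x = v x" "\<forall>x\<in>set (ys i). w x \<in> carrier G.N"
      \<comment> \<open>Elements of \<open>N\<close> are names fixed by \<open>rep\<close>, so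
        \<open>w\<close>, cut down to the relevant variables, is its own naming.\<close>
      define \<sigma> where "\<sigma> x = (if x \<in> set (ys i) then w x else 0)" for x
      have \<sigma>: "\<sigma> \<in> eventually_zero" unfolding \<sigma>_def by (rule eventually_zero_restrict) simp
      have "sat G.N (\<phi> i) (G.rep \<circ> \<sigma>)"
      proof (rule G.truth[OF _ \<sigma>])
        show "subfms (\<phi> i) \<subseteq> F" by (auto simp: F_def)
        show "G.forced (\<lambda>v. sat M (\<phi> i) (v \<circ> \<sigma>))"
          unfolding G.forced_def using G.S_asg by (intro exI[of _ 0] ballI M\<phi> asg_comp) auto
      qed
      moreover have "(G.rep \<circ> \<sigma>) x = w x" if "x \<in> fv (\<phi> i)" for x
      proof -
        have "x \<in> set (ys i)" using that \<phi>(2) by auto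
        moreover from this obtain k where "w x = G.rep k" using w(2) by (auto simp: G.N_def)
        ultimately show ?thesis by (simp add: \<sigma>_def G.rep_rep)
      qed
      then have "sat G.N (\<phi> i) (G.rep \<circ> \<sigma>) \<longleftrightarrow> sat G.N (\<phi> i) w" by (rule sat_cong)
      ultimately show "sat G.N (\<phi> i) w" by simp
    qed
  qed
  moreover have "omits G.N (xs i) (\<Gamma> i)" for i
    unfolding omits_def
  proof
    assume "\<exists>as\<in>tuples G.N (length (xs i)). \<forall>\<gamma>\<in>\<Gamma> i. sat_tuple G.N (xs i) \<gamma> as"
    then obtain as where as: "as \<in> tuples G.N (length (xs i))"
      "\<And>\<gamma>. \<gamma> \<in> \<Gamma> i \<Longrightarrow> sat_tuple G.N (xs i) \<gamma> as" by blast
    \<comment> \<open>Again the tuple names itself, and the requirement \<open>avoid\<close> for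
      this naming was met at some stage.\<close>
    define \<sigma> where "\<sigma> x = (if x \<in> set (xs i) then the (map_of (zip (xs i) as) x) else 0)" for x
    have \<sigma>: "\<sigma> \<in> eventually_zero" unfolding \<sigma>_def by (rule eventually_zero_restrict) simp
    then have "\<exists>n. avoid i \<sigma> (S n)" by (intro S(3)) (auto simp: \<D>_def)
    then obtain \<gamma> where \<gamma>: "\<gamma> \<in> \<Gamma>' i" "G.forced (\<lambda>v. sat M (neg \<gamma>) (v \<circ> \<sigma>))"
      unfolding avoid_def G.forced_def by blast
    have "subfms (neg \<gamma>) \<subseteq> F" using \<gamma>(1) by (auto simp: F_def)
    from G.truth[OF this \<sigma> \<gamma>(2)] have "\<not> sat G.N \<gamma> (G.rep \<circ> \<sigma>)" by simp
    moreover have "sat_tuple G.N (xs i) \<gamma> as \<longleftrightarrow> sat G.N \<gamma> (G.rep \<circ> \<sigma>)"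
    proof (rule sat_tuple_iff)
      show "fv \<gamma> \<subseteq> set (xs i)" using type[of i] \<gamma>(1) by (auto simp: Pi_type_def)
      show "length as = length (xs i)" using as(1) by (simp add: tuples_def)
      fix x assume x: "x \<in> set (xs i)"
      then have "the (map_of (zip (xs i) as) x) \<in> carrier G.N"
        using map_of_zip_in_set[of as "xs i" x] as(1) by (auto simp: tuples_def)
      then obtain k where "the (map_of (zip (xs i) as) x) = G.rep k" by (auto simp: G.N_def)
      then show "(G.rep \<circ> \<sigma>) x = the (map_of (zip (xs i) as) x)"
        using x by (simp add: \<sigma>_def G.rep_rep)
    qed
    ultimately show False using as(2) \<gamma>(1) \<Gamma>'(1) by blast
  qed
  ultimately show ?thesis using G.structure_N by blast
qed

end
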